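(* Let $X\subset\mathbb{R}^n$ be compact and convex, let $Y=\{y_1,\dots,y_N\}\subset\mathbb{R}^n$ be a set of $N$ points, let $\rho$ be a probability measure on $X$, absolutely continuous with respect to Lebesgue measure, whose density satisfies $0<\underline{m}\le\rho(x)\le\overline{m}<\infty$ on $X$ for some constants $\underline{m},\overline{m}$, and let $\mu=\sum_{k=1}^N\mu_k\delta_{y_k}$ be a probability measure with $\mu_k\ge\underline{\mu}>0$ for all $k$. Let $c:X\times Y\to\mathbb{R}$ be of class $C^1$ in $x$ and such that for every $x_0\in X$ the map $Y\ni y\mapsto\nabla_x c(x_0,y)$ is injective. For $t\in[0,1)$ let $\psi(t)$ be the solution of $\min_{\psi\in\mathbb{R}^N}\Phi(\psi,t)$ normalized by $\sum_i\psi_i(t)=0$. Then the trajectory $t\mapsto\psi(t)$ is smooth and is characterized on $[0,1)$ as the unique solution $\psi(t)\in U$ of the Cauchy problem $$\begin{cases}\nabla^2_{\psi,\psi}\Phi(\psi(t),t)\,\psi'(t)+\dfrac{\partial}{\partial t}\nabla_\psi\Phi(\psi(t),t)=0,& t\in[0,1),\\[4pt] \psi(0)=\log\mu-\dfrac1N\sum_{k=1}^N\log\mu_k.\end{cases}$$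
   Context: For $\psi\in\mathbb{R}^N$ and $t\in[0,1)$, $$\Phi(\psi,t)=\int_X(1-t)\log\Big[\sum_{k=1}^N e^{\frac{\psi_k-tc(x,y_k)}{1-t}}\Big]d\rho(x)-\sum_{k=1}^N\psi_k\mu_k-(1-t).$$ $\nabla_\psi\Phi$ and $\nabla^2_{\psi,\psi}\Phi$ are the gradient and Hessian in $\psi$, and $\frac{\partial}{\partial t}\nabla_\psi\Phi(\psi(t),t)$ is the partial derivative in $t$ of $(\psi,t)\mapsto\nabla_\psi\Phi(\psi,t)$ evaluated at $\psi=\psi(t)$. The initial condition is read componentwise: $\psi_i(0)=\log\mu_i-\frac1N\sum_{k}\log\mu_k$. Set $\|c\|_\infty=\max_{X\times Y}|c|$ and $U=\{\psi\in\mathbb{R}^N:\ \|\psi\|\le2\|c\|_\infty,\ \sum_i\psi_i=0\}$, with $\|\psi\|=\max_i|\psi_i|$.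
   Formalization: Membership and uniqueness in U are asserted only when ψ(0) lies in U (necessary: for small c and unequal weights ψ(0) is outside U); without that condition ψ is shown to be the unique solution among all curves with zero coordinate sum. *)

theory Defs
  imports "HOL-Probability.Probability"
begin

text \<open>
  The gradient of a real-valued function along a filter: \<open>at p\<close> gives the ordinary gradient,
  \<open>at x within X\<close> the gradient up to the boundary of \<open>X\<close> (unique when \<open>X\<close> is convex with
  nonempty interior).
\<close>

definition gradient :: "('a::real_inner \<Rightarrow> real) \<Rightarrow> 'a filter \<Rightarrow> 'a" where
  "gradient f F = (THE g. (f has_derivative (\<lambda>h. g \<bullet> h)) F)"

definition C1_on :: "'a::real_inner set \<Rightarrow> ('a \<Rightarrow> real) \<Rightarrow> bool" where
  "C1_on X f \<longleftrightarrow> (\<forall>x\<in>X. f differentiable (at x within X)) \<and>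
     continuous_on X (\<lambda>x. gradient f (at x within X))"

text \<open>
  Infinitely differentiable on a set of parameters, with derivatives taken within the set
  (one-sided at the left end point of \<open>[0,1)\<close>); \<open>D n\<close> is the derivative of order \<open>n\<close>.
\<close>

definition smooth_on :: "real set \<Rightarrow> (real \<Rightarrow> 'a::real_normed_vector) \<Rightarrow> bool" where
  "smooth_on S f \<longleftrightarrow> (\<exists>D :: nat \<Rightarrow> real \<Rightarrow> 'a. (\<forall>t\<in>S. D 0 t = f t) \<and>
     (\<forall>n. \<forall>t\<in>S. (D n has_vector_derivative D (Suc n) t) (at t within S)))"

text \<open>
  The points are \<open>y k\<close> for \<open>k\<close> in a finite type \<open>'k\<close>, so \<open>N = CARD('k)\<close>; the measure
  \<open>\<mu> = (\<Sum>k. \<mu>\<^sub>k \<delta>\<^bsub>y k\<^esub>)\<close> is given by its vector of weights.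
\<close>

definition Phi ::
  "'a measure \<Rightarrow> ('a \<Rightarrow> 'b \<Rightarrow> real) \<Rightarrow> ('k::finite \<Rightarrow> 'b) \<Rightarrow> real^'k \<Rightarrow> real^'k \<Rightarrow> real \<Rightarrow> real" where
  "Phi \<rho> c y \<mu> \<psi> t =
     (\<integral>x. (1 - t) * ln (\<Sum>k\<in>UNIV. exp ((\<psi> $ k - t * c x (y k)) / (1 - t))) \<partial>\<rho>)
     - (\<Sum>k\<in>UNIV. \<psi> $ k * \<mu> $ k) - (1 - t)"

definition grad_Phi ::
  "'a measure \<Rightarrow> ('a \<Rightarrow> 'b \<Rightarrow> real) \<Rightarrow> ('k::finite \<Rightarrow> 'b) \<Rightarrow> real^'k \<Rightarrow> real^'k \<Rightarrow> real \<Rightarrow> real^'k" where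
  "grad_Phi \<rho> c y \<mu> \<psi> t = gradient (\<lambda>p. Phi \<rho> c y \<mu> p t) (at \<psi>)"

definition hess_Phi ::
  "'a measure \<Rightarrow> ('a \<Rightarrow> 'b \<Rightarrow> real) \<Rightarrow> ('k::finite \<Rightarrow> 'b) \<Rightarrow> real^'k \<Rightarrow> real^'k \<Rightarrow> real \<Rightarrow> real^'k^'k" where
  "hess_Phi \<rho> c y \<mu> \<psi> t = jacobian (\<lambda>p. grad_Phi \<rho> c y \<mu> p t) (at \<psi>)"

definition dt_grad_Phi ::
  "'a measure \<Rightarrow> ('a \<Rightarrow> 'b \<Rightarrow> real) \<Rightarrow> ('k::finite \<Rightarrow> 'b) \<Rightarrow> real^'k \<Rightarrow> real^'k \<Rightarrow> real \<Rightarrow> real^'k" where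
  "dt_grad_Phi \<rho> c y \<mu> \<psi> t =
     vector_derivative (\<lambda>s. grad_Phi \<rho> c y \<mu> \<psi> s) (at t within {0..<1})"

definition normalized_min ::
  "'a measure \<Rightarrow> ('a \<Rightarrow> 'b \<Rightarrow> real) \<Rightarrow> ('k::finite \<Rightarrow> 'b) \<Rightarrow> real^'k \<Rightarrow> real \<Rightarrow> real^'k \<Rightarrow> bool" where
  "normalized_min \<rho> c y \<mu> t \<psi> \<longleftrightarrow>
     is_arg_min (\<lambda>p. Phi \<rho> c y \<mu> p t) (\<lambda>_. True) \<psi> \<and> (\<Sum>i\<in>UNIV. \<psi> $ i) = 0"

definition psi_opt ::
  "'a measure \<Rightarrow> ('a \<Rightarrow> 'b \<Rightarrow> real) \<Rightarrow> ('k::finite \<Rightarrow> 'b) \<Rightarrow> real^'k \<Rightarrow> real \<Rightarrow> real^'k" where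
  "psi_opt \<rho> c y \<mu> t = (THE \<psi>. normalized_min \<rho> c y \<mu> t \<psi>)"

definition psi_init :: "real^'k \<Rightarrow> real^'k::finite" where
  "psi_init \<mu> = (\<chi> i. ln (\<mu> $ i) - (\<Sum>k\<in>UNIV. ln (\<mu> $ k)) / real CARD('k))"

definition cauchy_solution ::
  "'a measure \<Rightarrow> ('a \<Rightarrow> 'b \<Rightarrow> real) \<Rightarrow> ('k::finite \<Rightarrow> 'b) \<Rightarrow> real^'k \<Rightarrow> (real \<Rightarrow> real^'k) \<Rightarrow> bool" where
  "cauchy_solution \<rho> c y \<mu> \<phi> \<longleftrightarrow>
     (\<forall>t\<in>{0..<1}. \<exists>v. (\<phi> has_vector_derivative v) (at t within {0..<1}) \<and>
        hess_Phi \<rho> c y \<mu> (\<phi> t) t *v v + dt_grad_Phi \<rho> c y \<mu> (\<phi> t) t = 0) \<and>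
     \<phi> 0 = psi_init \<mu>"

text \<open>
  \<open>\<psi>\<close> is, on \<open>[0,1)\<close>, the one and only solution with values in \<open>A\<close>: the equivalence says both that
  \<open>\<psi>\<close> is such a solution (take \<open>\<phi> = \<psi>\<close>) and that any such solution agrees with \<open>\<psi>\<close>.
\<close>

definition unique_cauchy_solution_in ::
  "'a measure \<Rightarrow> ('a \<Rightarrow> 'b \<Rightarrow> real) \<Rightarrow> ('k::finite \<Rightarrow> 'b) \<Rightarrow> real^'k \<Rightarrow> (real^'k) set
    \<Rightarrow> (real \<Rightarrow> real^'k) \<Rightarrow> bool" where
  "unique_cauchy_solution_in \<rho> c y \<mu> A \<psi> \<longleftrightarrow>
     (\<forall>\<phi>. (cauchy_solution \<rho> c y \<mu> \<phi> \<and> (\<forall>t\<in>{0..<1}. \<phi> t \<in> A)) \<longleftrightarrow> (\<forall>t\<in>{0..<1}. \<phi> t = \<psi> t))"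

definition sup_norm :: "'a set \<Rightarrow> 'b set \<Rightarrow> ('a \<Rightarrow> 'b \<Rightarrow> real) \<Rightarrow> real" where
  "sup_norm X Y c = (SUP (x, y)\<in>X \<times> Y. \<bar>c x y\<bar>)"

definition zero_sum :: "(real^'k::finite) set" where
  "zero_sum = {\<psi>. (\<Sum>i\<in>UNIV. \<psi> $ i) = 0}"

text \<open>
  The initial datum \<open>psi_init \<mu>\<close> does not depend on \<open>c\<close>, so for small \<open>c\<close> and unequal weights it
  lies outside \<open>U_set\<close>, and then no solution takes its values there.  Values in \<open>U_set\<close> can
  therefore only be asserted for data in \<open>U_set\<close>; in \<open>zero_sum\<close> no condition is needed.
\<close>

definition U_set :: "'a set \<Rightarrow> 'b set \<Rightarrow> ('a \<Rightarrow> 'b \<Rightarrow> real) \<Rightarrow> (real^'k::finite) set" where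
  "U_set X Y c = {\<psi>. infnorm \<psi> \<le> 2 * sup_norm X Y c \<and> (\<Sum>i\<in>UNIV. \<psi> $ i) = 0}"

end

theory Submission
  imports Defs
begin

text \<open>
  The substitution \<open>q = \<psi> / (1 - t)\<close>, \<open>s = t / (1 - t)\<close> turns the functional into
  \<open>\<Phi>(\<psi>,t) = (1 - t) (J(q,s) - 1)\<close> with \<open>J(q,s) = \<integral> lse (q - s C(x)) d\<rho>(x) - q \<bullet> \<mu>\<close>, where
  \<open>C(x) = (c(x, y\<^sub>k))\<^sub>k\<close> and \<open>lse\<close> is log-sum-exp.  The parameters \<open>q\<close> and \<open>s\<close> now enter linearly and
  range over all of \<open>\<real>\<^sup>N\<close> and \<open>\<real>\<close>, so every bound on derivatives is global, and
  \<open>\<nabla>\<^sub>\<psi>\<Phi>(\<psi>,t) = G(q,s) - \<mu>\<close> with \<open>G(q,s) = \<integral> softmax (q - s C(x)) d\<rho>(x)\<close>.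

  Minimisers.  \<open>J\<close> is invariant under adding constants to \<open>q\<close> and coercive on zero-sum vectors because
  all \<open>\<mu>\<^sub>k\<close> are positive, so a zero-sum minimiser exists.  It is a critical point, \<open>G(q,s) = \<mu>\<close>, and
  softmax is strictly monotone modulo constants, so there is exactly one zero-sum critical point
  (\<open>ex1_optimal\<close>), denoted \<open>optimal s\<close>.

  Smoothness.  Adding the sum of the coordinates to every coordinate of \<open>G(q,s) - \<mu>\<close> gives a map that is
  injective in \<open>q\<close> and has an invertible derivative, so the implicit function theorem makes \<open>optimal\<close>
  differentiable, and Cramer's rule expresses its derivative by integrals of polynomials in softmax and
  the costs.  For derivatives of all orders, consider the class of functions of \<open>(t,x)\<close> generated by the
  potentials, \<open>t\<close> and bounded functions of \<open>x\<close> under sums, products, exponentials, reciprocals and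
  integration over \<open>x\<close>: it is stable under \<open>d/dt\<close> (\<open>alg_deriv\<close>), hence all its members are smooth.

  The Cauchy problem.  Its equation says that \<open>\<nabla>\<^sub>\<psi>\<Phi>(\<phi>(t),t)\<close> has derivative zero
  (\<open>grad_Phi_along_curve\<close>), and its initial condition says that this gradient vanishes at \<open>t = 0\<close>.
  So the solutions with zero sum are exactly the curves of zero-sum critical points, that is, the
  trajectory of minimisers.

  Values in \<open>U\<close>.  Taking logarithms in \<open>G(q,s) = \<mu>\<close> shows that \<open>optimal s\<close> differs from the initial
  datum by at most \<open>2 s \<parallel>c\<parallel>\<close> in each coordinate.  Multiplying by \<open>1 - t\<close> gives
  \<open>|\<psi>\<^sub>i(t)| \<le> (1 - t) |\<psi>\<^sub>i(0)| + 2 t \<parallel>c\<parallel>\<close>, so the bound \<open>2 \<parallel>c\<parallel>\<close> persists if it holds initially.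
\<close>

section \<open>Differentiation under the integral sign\<close>

text \<open>
  The bound on the derivative makes the integrand Lipschitz on the ball, so the difference quotients
  are dominated by a constant, which is integrable for a finite measure.
\<close>

lemma has_derivative_integral_bounded:
  fixes f :: "'p::real_normed_vector \<Rightarrow> 'a \<Rightarrow> 'b::{banach, second_countable_topology}"
  assumes "finite_measure M" and e: "e > 0" and "K \<ge> 0"
    and int: "\<And>q. q \<in> ball p e \<Longrightarrow> integrable M (f q)"
    and meas: "\<And>h. (\<lambda>x. f' p x h) \<in> borel_measurable M"
    and deriv: "\<And>q x. q \<in> ball p e \<Longrightarrow> x \<in> space M \<Longrightarrow>
      ((\<lambda>q. f q x) has_derivative f' q x) (at q)"
    and bound: "\<And>q x h. q \<in> ball p e \<Longrightarrow> x \<in> space M \<Longrightarrow> norm (f' q x h) \<le> K * norm h"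
  shows "((\<lambda>q. \<integral>x. f q x \<partial>M) has_derivative (\<lambda>h. \<integral>x. f' p x h \<partial>M)) (at p)"
proof -
  interpret finite_measure M by fact
  have p: "p \<in> ball p e" using e by simp
  have lin: "bounded_linear (f' p x)" if "x \<in> space M" for x
    using deriv[OF p that] has_derivative_bounded_linear by blast
  have int': "integrable M (\<lambda>x. f' p x h)" for h
    by (rule integrable_const_bound[of _ "K * norm h"]) (use bound[OF p] meas in auto)
  have lip: "norm (f q x - f p x) \<le> K * norm (q - p)" if "q \<in> ball p e" "x \<in> space M" for q x
  proof (rule differentiable_bound[of "ball p e" "\<lambda>q. f q x" "\<lambda>q. f' q x"])
    fix z assume z: "z \<in> ball p e"
    show "((\<lambda>q. f q x) has_derivative f' z x) (at z within ball p e)"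
      using deriv[OF z that(2)] has_derivative_at_withinI by blast
    show "onorm (f' z x) \<le> K"
      by (rule onorm_bound) (use bound[OF z that(2)] \<open>K \<ge> 0\<close> in auto)
  qed (use that p in auto)
  have bl: "bounded_linear (\<lambda>h. \<integral>x. f' p x h \<partial>M)"
  proof (rule bounded_linear_intro[where K = "K * measure M (space M)"])
    show "(\<integral>x. f' p x (h + k) \<partial>M) = (\<integral>x. f' p x h \<partial>M) + (\<integral>x. f' p x k \<partial>M)" for h k
      using lin by (subst Bochner_Integration.integral_add[symmetric, OF int' int'])
        (auto intro!: Bochner_Integration.integral_cong simp: bounded_linear.linear linear_add)
    show "(\<integral>x. f' p x (r *\<^sub>R h) \<partial>M) = r *\<^sub>R (\<integral>x. f' p x h \<partial>M)" for r h
    proof -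
      have "(\<integral>x. f' p x (r *\<^sub>R h) \<partial>M) = (\<integral>x. r *\<^sub>R f' p x h \<partial>M)"
        using lin by (intro Bochner_Integration.integral_cong)
          (auto simp: bounded_linear.linear linear_scale)
      then show ?thesis by (simp add: int')
    qed
    show "norm (\<integral>x. f' p x h \<partial>M) \<le> norm h * (K * measure M (space M))" for h
    proof -
      have "norm (\<integral>x. f' p x h \<partial>M) \<le> (\<integral>x. norm (f' p x h) \<partial>M)"
        by (rule integral_norm_bound)
      also have "\<dots> \<le> (\<integral>x. K * norm h \<partial>M)"
        by (rule integral_mono) (use int' bound[OF p] in auto)
      finally show ?thesis by (simp add: mult_ac)
    qed
  qed
  define R where "R q x = (1 / norm (q - p)) *\<^sub>R (f q x - (f p x + f' p x (q - p)))" for q x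
  have "((\<lambda>q. \<integral>x. R q x \<partial>M) \<longlongrightarrow> 0) (at p within ball p e)"
    unfolding tendsto_at_iff_sequentially comp_def
  proof (intro allI impI)
    fix S assume S: "\<forall>i. S i \<in> ball p e - {p}" and lim: "S \<longlonglongrightarrow> p"
    have "(\<lambda>i. \<integral>x. R (S i) x \<partial>M) \<longlonglongrightarrow> (\<integral>x. 0 \<partial>M)"
    proof (rule integral_dominated_convergence[where w = "\<lambda>_. 2 * K"])
      show "AE x in M. (\<lambda>i. R (S i) x) \<longlonglongrightarrow> 0"
      proof (rule AE_I2)
        fix x assume x: "x \<in> space M"
        have "((\<lambda>q. R q x) \<longlongrightarrow> 0) (at p)"
          using deriv[OF p x] unfolding has_derivative_at2 R_def by blast
        then have "((\<lambda>q. R q x) \<longlongrightarrow> 0) (at p within ball p e)"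
          by (rule tendsto_within_subset) simp
        then show "(\<lambda>i. R (S i) x) \<longlonglongrightarrow> 0"
          using S lim unfolding tendsto_at_iff_sequentially comp_def by blast
      qed
      show "AE x in M. norm (R (S i) x) \<le> 2 * K" for i
      proof (rule AE_I2)
        fix x assume x: "x \<in> space M"
        have q: "S i \<in> ball p e" "norm (S i - p) > 0" using S by auto
        have "norm (f (S i) x - (f p x + f' p x (S i - p)))
            \<le> norm (f (S i) x - f p x) + norm (f' p x (S i - p))"
          by (metis diff_diff_eq norm_triangle_ineq4)
        also have "\<dots> \<le> 2 * K * norm (S i - p)"
          using lip[OF q(1) x] bound[OF p x, of "S i - p"] by linarith
        finally show "norm (R (S i) x) \<le> 2 * K"
          unfolding R_def norm_scaleR using q(2) by (simp add: pos_divide_le_eq)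
      qed
      show "R (S i) \<in> borel_measurable M" for i
        unfolding R_def using int[of "S i"] int[OF p] meas S by (intro measurable) auto
    qed auto
    then show "(\<lambda>i. \<integral>x. R (S i) x \<partial>M) \<longlonglongrightarrow> 0" by simp
  qed
  then have "((\<lambda>q. \<integral>x. R q x \<partial>M) \<longlongrightarrow> 0) (at p)"
    using at_within_open[of p "ball p e"] p by simp
  moreover have "\<forall>\<^sub>F q in at p. (\<integral>x. R q x \<partial>M) = (1 / norm (q - p)) *\<^sub>R
      ((\<integral>x. f q x \<partial>M) - ((\<integral>x. f p x \<partial>M) + (\<integral>x. f' p x (q - p) \<partial>M)))"
  proof -
    have "\<forall>\<^sub>F q in at p. q \<in> ball p e"
      using e by (intro eventually_at_in_open') auto
    then show ?thesis
      by eventually_elim (use int int' p in \<open>simp add: R_def\<close>)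
  qed
  ultimately show ?thesis
    unfolding has_derivative_at2 using bl tendsto_cong by fastforce
qed

section \<open>Log-sum-exp and softmax\<close>

definition lse :: "real^'k::finite \<Rightarrow> real" where
  "lse z = ln (\<Sum>k\<in>UNIV. exp (z $ k))"

definition softmax :: "real^'k::finite \<Rightarrow> real^'k" where
  "softmax z = (\<chi> i. exp (z $ i) / (\<Sum>k\<in>UNIV. exp (z $ k)))"

definition softmax_deriv :: "real^'k::finite \<Rightarrow> real^'k \<Rightarrow> real^'k" where
  "softmax_deriv z h = (\<chi> i. softmax z $ i * (h $ i - softmax z \<bullet> h))"

lemma sum_exp_pos: "0 < (\<Sum>k\<in>UNIV. exp (z $ k))" for z :: "real^'k::finite"
  by (intro sum_pos) auto

lemma sum_exp_nz [simp]: "(\<Sum>k\<in>UNIV. exp (z $ k)) \<noteq> 0" for z :: "real^'k::finite"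
  using sum_exp_pos[of z] by simp

lemma softmax_pos: "0 < softmax z $ i"
  by (simp add: softmax_def sum_exp_pos)

lemma sum_softmax: "(\<Sum>i\<in>UNIV. softmax z $ i) = 1"
  by (simp add: softmax_def flip: sum_divide_distrib)

lemma norm_softmax_le: "norm (softmax z) \<le> 1"
  using norm_le_l1_cart[of "softmax z"] by (simp add: sum_softmax softmax_pos less_imp_le)

text \<open>
  Softmax inverts the logarithm up to an additive constant; monotonicity of softmax thereby reduces
  to monotonicity of \<open>ln\<close>.
\<close>

lemma ln_softmax: "ln (softmax z $ i) = z $ i - lse z"
  by (simp add: softmax_def lse_def ln_div sum_exp_pos)

lemma lse_ge: "z $ i \<le> lse z"
proof -
  have "exp (z $ i) \<le> (\<Sum>k\<in>UNIV. exp (z $ k))"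
    by (rule member_le_sum) auto
  then show ?thesis
    unfolding lse_def by (simp add: ln_ge_iff sum_exp_pos)
qed

lemma lse_add_vec: "lse (z + vec a) = lse z + a"
proof -
  have "lse (z + vec a) = ln ((\<Sum>k\<in>UNIV. exp (z $ k)) * exp a)"
    by (simp add: lse_def exp_add sum_distrib_right)
  then show ?thesis
    by (simp add: lse_def ln_mult sum_exp_pos)
qed

lemma has_derivative_vecI:
  fixes f :: "'a::real_normed_vector \<Rightarrow> real^'k::finite"
  assumes "\<And>i. ((\<lambda>x. f x $ i) has_derivative (\<lambda>h. f' h $ i)) F"
  shows "(f has_derivative f') F"
proof -
  have 1: "f = (\<lambda>x. \<Sum>i\<in>UNIV. f x $ i *\<^sub>R axis i 1)" "f' = (\<lambda>x. \<Sum>i\<in>UNIV. f' x $ i *\<^sub>R axis i 1)"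
    by (auto simp: vec_eq_iff axis_def if_distrib cong: if_cong)
  show ?thesis
    by (subst 1, subst 1(2)) (intro has_derivative_sum has_derivative_scaleR_left assms)
qed

lemma inner_softmax: "softmax z \<bullet> h = (\<Sum>k\<in>UNIV. exp (z $ k) * h $ k) / (\<Sum>k\<in>UNIV. exp (z $ k))"
  by (simp add: softmax_def inner_vec_def sum_divide_distrib)

lemma has_derivative_exp_nth:
  "((\<lambda>z::real^'k::finite. exp (z $ i)) has_derivative (\<lambda>h. exp (z $ i) * h $ i)) (at z)"
  using has_derivative_exp[OF bounded_linear_imp_has_derivative[OF bounded_linear_vec_nth]]
  by (simp add: mult.commute)

lemma has_derivative_sum_exp:
  "((\<lambda>z::real^'k::finite. \<Sum>k\<in>UNIV. exp (z $ k)) has_derivative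
     (\<lambda>h. \<Sum>k\<in>UNIV. exp (z $ k) * h $ k)) (at z)"
  by (intro has_derivative_sum has_derivative_exp_nth)

lemma has_derivative_lse: "(lse has_derivative (\<lambda>h. softmax z \<bullet> h)) (at z)"
  using has_derivative_ln[OF sum_exp_pos has_derivative_sum_exp, of z]
  by (simp add: lse_def[abs_def] inner_softmax divide_inverse mult.commute)

lemma has_derivative_softmax: "(softmax has_derivative softmax_deriv z) (at z)"
proof (rule has_derivative_vecI)
  fix i
  show "((\<lambda>z. softmax z $ i) has_derivative (\<lambda>h. softmax_deriv z h $ i)) (at z)"
    unfolding softmax_deriv_def inner_softmax unfolding softmax_def vec_lambda_beta
    by (rule has_derivative_eq_rhs, rule has_derivative_divide'[OF has_derivative_exp_nth has_derivative_sum_exp])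
       (auto simp: fun_eq_iff field_simps)
qed

lemma norm_softmax_deriv_le:
  fixes z :: "real^'k::finite"
  shows "norm (softmax_deriv z h) \<le> 2 * norm h"
proof -
  have ih: "\<bar>softmax z \<bullet> h\<bar> \<le> norm h"
    using Cauchy_Schwarz_ineq2[of "softmax z" h] mult_right_mono[OF norm_softmax_le[of z], of "norm h"]
    by simp
  have "norm (softmax_deriv z h) \<le> (\<Sum>i\<in>UNIV. \<bar>softmax_deriv z h $ i\<bar>)"
    by (rule norm_le_l1_cart)
  also have "\<dots> \<le> (\<Sum>i\<in>UNIV. softmax z $ i * (2 * norm h))"
  proof (rule sum_mono)
    fix i
    have "\<bar>h $ i - softmax z \<bullet> h\<bar> \<le> 2 * norm h"
      using ih component_le_norm_cart[of h i] by linarith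
    then show "\<bar>softmax_deriv z h $ i\<bar> \<le> softmax z $ i * (2 * norm h)"
      by (simp add: softmax_deriv_def abs_mult softmax_pos mult_left_mono less_imp_le)
  qed
  also have "\<dots> = 2 * norm h"
    by (simp add: sum_softmax flip: sum_distrib_right)
  finally show ?thesis .
qed

text \<open>
  The quadratic form of the derivative is the variance of \<open>h\<close> under the weights \<open>softmax z\<close>; it
  vanishes only on constant vectors because all weights are positive.
\<close>

lemma softmax_deriv_quadratic:
  "h \<bullet> softmax_deriv z h = (\<Sum>i\<in>UNIV. softmax z $ i * (h $ i - softmax z \<bullet> h)\<^sup>2)"
proof -
  let ?m = "softmax z \<bullet> h"
  have 0: "(\<Sum>i\<in>UNIV. softmax z $ i * (h $ i - ?m)) = 0"
  proof -
    have "(\<Sum>i\<in>UNIV. softmax z $ i * (h $ i - ?m))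
        = ?m - (\<Sum>i\<in>UNIV. softmax z $ i) * ?m"
      by (simp add: inner_vec_def right_diff_distrib sum_subtractf sum_distrib_right)
    then show ?thesis by (simp add: sum_softmax)
  qed
  have "h \<bullet> softmax_deriv z h
      = (\<Sum>i\<in>UNIV. softmax z $ i * (h $ i - ?m)\<^sup>2 + ?m * (softmax z $ i * (h $ i - ?m)))"
    unfolding inner_vec_def[of h]
    by (intro sum.cong) (auto simp: softmax_deriv_def power2_eq_square algebra_simps)
  also have "\<dots> = (\<Sum>i\<in>UNIV. softmax z $ i * (h $ i - ?m)\<^sup>2)"
    by (simp add: sum.distrib 0 flip: sum_distrib_left)
  finally show ?thesis .
qed

lemma softmax_deriv_nonneg: "0 \<le> h \<bullet> softmax_deriv z h"
  unfolding softmax_deriv_quadratic by (intro sum_nonneg) (simp add: softmax_pos less_imp_le)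

lemma softmax_deriv_eq_0D:
  assumes "h \<bullet> softmax_deriv z h = 0"
  shows "h = vec (softmax z \<bullet> h)"
proof -
  have "\<forall>i\<in>UNIV. softmax z $ i * (h $ i - softmax z \<bullet> h)\<^sup>2 = 0"
    using assms unfolding softmax_deriv_quadratic
    by (subst (asm) sum_nonneg_eq_0_iff) (auto simp: softmax_pos less_imp_le)
  then show ?thesis
    by (simp add: vec_eq_iff less_imp_neq[OF softmax_pos, symmetric])
qed

text \<open>
  Since \<open>z\<^sub>i - w\<^sub>i\<close> and \<open>ln (softmax z)\<^sub>i - ln (softmax w)\<^sub>i\<close> differ by a constant and both softmax vectors
  sum to one, the inner product is a sum of terms \<open>(a - b) (ln a - ln b) \<ge> 0\<close>.
\<close>

lemma softmax_monotone:
  "0 \<le> (softmax z - softmax w) \<bullet> (z - w)"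
  "(softmax z - softmax w) \<bullet> (z - w) = 0 \<Longrightarrow> z - w = vec (lse z - lse w)"
proof -
  define d where "d i = (softmax z $ i - softmax w $ i) * (ln (softmax z $ i) - ln (softmax w $ i))" for i
  have d0: "0 \<le> d i" for i
    using ln_less_cancel_iff[OF softmax_pos[of z i] softmax_pos[of w i]]
      ln_less_cancel_iff[OF softmax_pos[of w i] softmax_pos[of z i]]
    by (cases "softmax z $ i" "softmax w $ i" rule: linorder_cases)
       (auto simp: d_def zero_le_mult_iff)
  have eq: "(softmax z - softmax w) \<bullet> (z - w) = (\<Sum>i\<in>UNIV. d i)"
  proof -
    have "(softmax z - softmax w) \<bullet> (z - w) =
       (\<Sum>i\<in>UNIV. d i + (lse z - lse w) * (softmax z $ i - softmax w $ i))"
      unfolding inner_vec_def d_def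
      by (intro sum.cong) (auto simp: ln_softmax algebra_simps)
    also have "\<dots> = (\<Sum>i\<in>UNIV. d i)"
      by (simp add: sum.distrib sum_subtractf sum_softmax flip: sum_distrib_left)
    finally show ?thesis .
  qed
  show "0 \<le> (softmax z - softmax w) \<bullet> (z - w)"
    unfolding eq using d0 by (simp add: sum_nonneg)
  assume "(softmax z - softmax w) \<bullet> (z - w) = 0"
  then have "d i = 0" for i
    unfolding eq using d0 by (simp add: sum_nonneg_eq_0_iff)
  then have "ln (softmax z $ i) = ln (softmax w $ i)" for i
    unfolding d_def mult_eq_0_iff by (metis eq_iff_diff_eq_0)
  then show "z - w = vec (lse z - lse w)"
    by (auto simp: vec_eq_iff ln_softmax algebra_simps)
qed

lemma abs_lse_le:
  fixes z :: "real^'k::finite"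
  shows "\<bar>lse z\<bar> \<le> ln CARD('k) + norm z"
proof -
  have "(\<Sum>k\<in>UNIV. exp (z $ k)) \<le> (\<Sum>k\<in>(UNIV::'k set). exp (norm z))"
    using component_le_norm_cart[of z] by (intro sum_mono) (simp add: abs_le_iff)
  then have "lse z \<le> ln (CARD('k) * exp (norm z))"
    unfolding lse_def by (intro ln_mono) (auto simp: sum_exp_pos)
  then have "lse z \<le> ln CARD('k) + norm z"
    by (simp add: ln_mult)
  moreover have "- norm z \<le> lse z"
    using component_le_norm_cart[of z undefined] lse_ge[of z undefined] by linarith
  moreover have "0 \<le> ln CARD('k)"
    by (simp add: Suc_leI)
  ultimately show ?thesis by linarith
qed

section \<open>The rescaled dual problem\<close>

lemma borel_measurable_vec_nth [measurable]:
  fixes f :: "'a \<Rightarrow> real^'k::finite"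
  assumes [measurable]: "f \<in> borel_measurable M"
  shows "(\<lambda>x. f x $ i) \<in> borel_measurable M"
  unfolding cart_eq_inner_axis by measurable

lemma borel_measurable_vec_lambda:
  fixes f :: "'a \<Rightarrow> 'k::finite \<Rightarrow> real"
  assumes [measurable]: "\<And>i. (\<lambda>x. f x i) \<in> borel_measurable M"
  shows "(\<lambda>x. \<chi> i. f x i) \<in> borel_measurable M"
proof -
  have "(\<lambda>x. \<chi> i. f x i) = (\<lambda>x. \<Sum>i\<in>UNIV. f x i *\<^sub>R axis i 1)"
    by (auto simp: vec_eq_iff axis_def if_distrib cong: if_cong)
  then show ?thesis by simp
qed

lemma borel_measurable_lse [measurable]: "lse \<in> borel_measurable borel"
  unfolding lse_def[abs_def] by measurable

lemma borel_measurable_softmax [measurable]: "softmax \<in> borel_measurable borel"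
  unfolding softmax_def[abs_def] by (intro borel_measurable_vec_lambda) measurable

lemma borel_measurable_softmax_deriv [measurable (raw)]:
  assumes [measurable]: "f \<in> borel_measurable M" "g \<in> borel_measurable M"
  shows "(\<lambda>x. softmax_deriv (f x) (g x)) \<in> borel_measurable M"
  unfolding softmax_deriv_def by (intro borel_measurable_vec_lambda) measurable

text \<open>
  The entries of \<open>C x\<close> are the costs of sending \<open>x\<close> to the target points, whose weights are \<open>\<mu>\<close>.
\<close>

locale soft_transport = prob_space M for M :: "'a measure" +
  fixes C :: "'a \<Rightarrow> real^'k::finite" and K :: real and \<mu> :: "real^'k"
  assumes C_measurable [measurable]: "C \<in> borel_measurable M"
    and C_bound: "x \<in> space M \<Longrightarrow> norm (C x) \<le> K"
    and \<mu>_pos: "0 < \<mu> $ k"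
    and \<mu>_sum: "(\<Sum>k\<in>UNIV. \<mu> $ k) = 1"
begin

lemma K_nonneg: "0 \<le> K"
  using not_empty C_bound norm_ge_zero order_trans by blast

text \<open>
  \<open>mass q s $ k\<close> is the mass that the entropic transport plan with potential \<open>q\<close> sends to the \<open>k\<close>-th
  target point; prescribing it to be \<open>\<mu>\<close> is the equation for a critical point of \<open>dual\<close>.
\<close>

definition mass :: "real^'k \<Rightarrow> real \<Rightarrow> real^'k" where
  "mass q s = (\<integral>x. softmax (q - s *\<^sub>R C x) \<partial>M)"

definition dual :: "real^'k \<Rightarrow> real \<Rightarrow> real" where
  "dual q s = (\<integral>x. lse (q - s *\<^sub>R C x) \<partial>M) - q \<bullet> \<mu>"

definition mass_deriv :: "(real^'k) \<times> real \<Rightarrow> (real^'k) \<times> real \<Rightarrow> real^'k" where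
  "mass_deriv p h = (\<integral>x. softmax_deriv (fst p - snd p *\<^sub>R C x) (fst h - snd h *\<^sub>R C x) \<partial>M)"

lemma norm_slack_le:
  assumes "x \<in> space M"
  shows "norm (fst h - snd h *\<^sub>R C x) \<le> (1 + K) * norm h"
proof -
  have "norm (fst h - snd h *\<^sub>R C x) \<le> norm (fst h) + \<bar>snd h\<bar> * norm (C x)"
    using norm_triangle_ineq4[of "fst h" "snd h *\<^sub>R C x"] by simp
  also have "\<dots> \<le> norm h + norm h * K"
    using norm_fst_le[of "fst h" "snd h"] norm_snd_le[of "snd h" "fst h"] C_bound[OF assms] K_nonneg
    by (intro add_mono mult_mono) auto
  finally show ?thesis by (simp add: algebra_simps)
qed

lemma integrable_softmax: "integrable M (\<lambda>x. softmax (q - s *\<^sub>R C x))"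
  by (rule integrable_const_bound[of _ 1]) (auto simp: norm_softmax_le)

lemma integrable_lse: "integrable M (\<lambda>x. lse (q - s *\<^sub>R C x))"
proof (rule integrable_const_bound[of _ "ln CARD('k) + (1 + K) * norm (q, s)"])
  show "AE x in M. norm (lse (q - s *\<^sub>R C x)) \<le> ln CARD('k) + (1 + K) * norm (q, s)"
    using norm_slack_le[of _ "(q, s)"] abs_lse_le[of "q - s *\<^sub>R C _"]
    by (intro AE_I2) (fastforce intro: order_trans)
qed measurable

lemma norm_softmax_deriv_slack_le:
  "x \<in> space M \<Longrightarrow> norm (softmax_deriv z (fst h - snd h *\<^sub>R C x)) \<le> 2 * (1 + K) * norm h"
  using norm_softmax_deriv_le[of z "fst h - snd h *\<^sub>R C x"] norm_slack_le[of x h] by linarith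

lemma integrable_softmax_deriv:
  "integrable M (\<lambda>x. softmax_deriv (fst p - snd p *\<^sub>R C x) (fst h - snd h *\<^sub>R C x))"
  by (rule integrable_const_bound[of _ "2 * (1 + K) * norm h"])
     (rule AE_I2, erule norm_softmax_deriv_slack_le, measurable)

lemma has_derivative_mass:
  "((\<lambda>p. mass (fst p) (snd p)) has_derivative mass_deriv p) (at p)"
  unfolding mass_def mass_deriv_def[abs_def]
proof (rule has_derivative_integral_bounded[where e = 1 and K = "2 * (1 + K)"
      and f' = "\<lambda>p x h. softmax_deriv (fst p - snd p *\<^sub>R C x) (fst h - snd h *\<^sub>R C x)"])
  show "((\<lambda>q. softmax (fst q - snd q *\<^sub>R C x)) has_derivative
      (\<lambda>h. softmax_deriv (fst q - snd q *\<^sub>R C x) (fst h - snd h *\<^sub>R C x))) (at q)" for q x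
    by (rule has_derivative_compose[OF _ has_derivative_softmax])
       (auto intro!: derivative_eq_intros)
qed (use K_nonneg finite_measure_axioms integrable_softmax norm_softmax_deriv_slack_le in auto)

lemma has_derivative_dual:
  "((\<lambda>q. dual q s) has_derivative (\<lambda>h. (mass q s - \<mu>) \<bullet> h)) (at q)"
proof -
  have "((\<lambda>q. \<integral>x. lse (q - s *\<^sub>R C x) \<partial>M) has_derivative
      (\<lambda>h. \<integral>x. softmax (q - s *\<^sub>R C x) \<bullet> h \<partial>M)) (at q)"
  proof (rule has_derivative_integral_bounded[where e = 1 and K = 1
      and f' = "\<lambda>q x h. softmax (q - s *\<^sub>R C x) \<bullet> h"])
    show "((\<lambda>q. lse (q - s *\<^sub>R C x)) has_derivative
        (\<lambda>h. softmax (q - s *\<^sub>R C x) \<bullet> h)) (at q)" for q x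
      by (rule has_derivative_compose[OF _ has_derivative_lse])
         (auto intro!: derivative_eq_intros)
    show "norm (softmax (q - s *\<^sub>R C x) \<bullet> h) \<le> 1 * norm h" for q x h
      using Cauchy_Schwarz_ineq2[of "softmax (q - s *\<^sub>R C x)" h]
        mult_right_mono[OF norm_softmax_le[of "q - s *\<^sub>R C x"], of "norm h"] by simp
  qed (use finite_measure_axioms integrable_lse in auto)
  then have "((\<lambda>q. \<integral>x. lse (q - s *\<^sub>R C x) \<partial>M) has_derivative (\<lambda>h. mass q s \<bullet> h)) (at q)"
    using integrable_softmax by (simp add: mass_def)
  then show ?thesis
    unfolding dual_def
    by (rule derivative_eq_intros) (auto intro!: derivative_eq_intros simp: inner_simps inner_commute)
qed

lemma continuous_on_dual: "continuous_on S (\<lambda>q. dual q s)"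
  using has_derivative_dual by (meson continuous_at_imp_continuous_on has_derivative_continuous)

lemma dual_add_vec: "dual (q + vec a) s = dual q s"
proof -
  have "vec a \<bullet> \<mu> = a"
    by (simp add: inner_vec_def \<mu>_sum flip: sum_distrib_left)
  moreover have "lse (q + vec a - s *\<^sub>R C x) = lse (q - s *\<^sub>R C x) + a" for x
    using lse_add_vec[of "q - s *\<^sub>R C x" a] by (simp add: algebra_simps)
  ultimately show ?thesis
    using integrable_lse by (simp add: dual_def inner_add_left prob_space)
qed

text \<open>
  Let \<open>q\<^sub>j\<close> be the largest entry.  As \<open>lse z \<ge> z\<^sub>j\<close>, the functional is at least
  \<open>\<Sum>\<^sub>k \<mu>\<^sub>k (q\<^sub>j - q\<^sub>k) - |s| K \<ge> m N q\<^sub>j - |s| K\<close>, and \<open>N q\<^sub>j\<close> bounds every entry of a zero-sum vector.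
\<close>

lemma dual_coercive:
  assumes "(\<Sum>k\<in>UNIV. q $ k) = 0" and "0 < m" "\<And>k. m \<le> \<mu> $ k"
  shows "m * \<bar>q $ i\<bar> \<le> dual q s + \<bar>s\<bar> * K"
proof -
  obtain j where j: "\<And>k. q $ k \<le> q $ j"
  proof -
    have "Max (range (($) q)) \<in> range (($) q)" by (intro Max_in) auto
    then obtain j where "Max (range (($) q)) = q $ j" by (metis imageE)
    then have "q $ k \<le> q $ j" for k by (metis Max_ge finite finite_imageI rangeI)
    then show thesis using that by blast
  qed
  have N: "(\<Sum>k\<in>UNIV. q $ j - q $ k) = CARD('k) * q $ j"
    by (simp add: sum_subtractf assms(1))
  moreover have "0 \<le> (\<Sum>k\<in>UNIV. q $ j - q $ k)"
    using j by (intro sum_nonneg) simp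
  ultimately have qj: "0 \<le> q $ j"
    by (simp add: zero_le_mult_iff)
  have "\<bar>q $ i\<bar> \<le> CARD('k) * q $ j"
  proof (rule abs_leI)
    have "q $ j \<le> CARD('k) * q $ j"
      using qj mult_right_mono[of 1 "real CARD('k)" "q $ j"] by (simp add: Suc_leI)
    then show "q $ i \<le> CARD('k) * q $ j"
      using j[of i] by linarith
    have "q $ j - q $ i \<le> CARD('k) * q $ j"
      unfolding N[symmetric] using j by (intro member_le_sum) auto
    then show "- (q $ i) \<le> CARD('k) * q $ j"
      using qj by linarith
  qed
  then have "m * \<bar>q $ i\<bar> \<le> m * (\<Sum>k\<in>UNIV. q $ j - q $ k)"
    using assms(2) unfolding N by (simp add: mult_left_mono)
  also have "\<dots> \<le> (\<Sum>k\<in>UNIV. \<mu> $ k * (q $ j - q $ k))"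
    unfolding sum_distrib_left using j assms(3) by (intro sum_mono mult_right_mono) auto
  also have "\<dots> = q $ j - q \<bullet> \<mu>"
    by (simp add: inner_vec_def right_diff_distrib sum_subtractf \<mu>_sum mult.commute[of "q $ _"]
        flip: sum_distrib_right)
  also have "\<dots> \<le> dual q s + \<bar>s\<bar> * K"
  proof -
    have "q $ j - \<bar>s\<bar> * K \<le> lse (q - s *\<^sub>R C x)" if "x \<in> space M" for x
    proof -
      have "s * C x $ j \<le> \<bar>s\<bar> * norm (C x)"
        using component_le_norm_cart[of "C x" j] abs_ge_self[of "s * C x $ j"]
          mult_left_mono[of "\<bar>C x $ j\<bar>" "norm (C x)" "\<bar>s\<bar>"] by (simp add: abs_mult)
      also have "\<dots> \<le> \<bar>s\<bar> * K"
        using C_bound[OF that] by (simp add: mult_left_mono)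
      finally show ?thesis
        using lse_ge[of "q - s *\<^sub>R C x" j] by simp
    qed
    then have "(\<integral>x. q $ j - \<bar>s\<bar> * K \<partial>M) \<le> (\<integral>x. lse (q - s *\<^sub>R C x) \<partial>M)"
      by (intro integral_mono) (auto simp: integrable_lse)
    then show ?thesis
      by (simp add: dual_def prob_space)
  qed
  finally show ?thesis .
qed

lemma zero_sum_shift:
  fixes p :: "real^'k"
  obtains a where "(\<Sum>k\<in>UNIV. (p + vec a) $ k) = 0"
  by (rule that[of "- (\<Sum>k\<in>UNIV. p $ k) / CARD('k)"]) (simp add: sum_subtractf)

lemma ex_zero_sum_minimiser:
  obtains q where "(\<Sum>k\<in>UNIV. q $ k) = 0" "\<And>p. dual q s \<le> dual p s"
proof -
  define m where "m = Min (range (($) \<mu>))"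
  have m: "0 < m" "\<And>k. m \<le> \<mu> $ k"
    using \<mu>_pos by (auto simp: m_def)
  let ?Z = "{q::real^'k. (\<Sum>k\<in>UNIV. q $ k) = 0}"
  \<comment> \<open>The radius bounds the l1 norm on the sublevel set of the origin, by coercivity.\<close>
  let ?S = "?Z \<inter> cball 0 (\<Sum>k\<in>(UNIV::'k set). (dual 0 s + \<bar>s\<bar> * K) / m)"
  have "closed ?Z"
    by (intro closed_Collect_eq continuous_intros)
  have in_S: "q \<in> ?S" if "q \<in> ?Z" "dual q s \<le> dual 0 s" for q
  proof -
    have "\<bar>q $ i\<bar> \<le> (dual 0 s + \<bar>s\<bar> * K) / m" for i
      using dual_coercive[of q m i s] that m by (simp add: pos_le_divide_eq mult.commute)
    then have "norm q \<le> (\<Sum>k\<in>(UNIV::'k set). (dual 0 s + \<bar>s\<bar> * K) / m)"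
      by (intro order_trans[OF norm_le_l1_cart sum_mono])
    then show ?thesis
      using that(1) by simp
  qed
  have "compact ?S"
    using \<open>closed ?Z\<close> by (intro closed_Int_compact) auto
  moreover have "0 \<in> ?S"
    by (rule in_S) auto
  ultimately obtain q where q: "q \<in> ?S" "\<And>p. p \<in> ?S \<Longrightarrow> dual q s \<le> dual p s"
    using continuous_attains_inf[of ?S "\<lambda>q. dual q s"] continuous_on_dual by blast
  have "dual q s \<le> dual p s" for p
  proof -
    obtain a where a: "(\<Sum>k\<in>UNIV. (p + vec a) $ k) = 0"
      by (rule zero_sum_shift)
    show ?thesis
    proof (cases "dual p s \<le> dual 0 s")
      case True
      then have "p + vec a \<in> ?S" using a by (intro in_S) (auto simp: dual_add_vec)
      then show ?thesis using q(2) dual_add_vec by metis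
    next
      case False
      then show ?thesis using q(2)[OF \<open>0 \<in> ?S\<close>] by linarith
    qed
  qed
  then show thesis using that[of q] q(1) by blast
qed

text \<open>
  The integrand \<open>(softmax (q - s C) - softmax (p - s C)) \<bullet> (q - p)\<close> is nonnegative, and wherever it
  vanishes \<open>q - p\<close> is constant, a condition that does not depend on \<open>x\<close>.
\<close>

lemma mass_strictly_monotone:
  assumes "(mass q s - mass p s) \<bullet> (q - p) = 0"
  shows "\<exists>a. q - p = vec a"
proof -
  define d where "d x = (softmax (q - s *\<^sub>R C x) - softmax (p - s *\<^sub>R C x)) \<bullet> (q - p)" for x
  have d: "0 \<le> d x" "d x = 0 \<Longrightarrow> \<exists>a. q - p = vec a" for x
    using softmax_monotone[of "q - s *\<^sub>R C x" "p - s *\<^sub>R C x"] by (auto simp: d_def)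
  have "integrable M d" "integral\<^sup>L M d = (mass q s - mass p s) \<bullet> (q - p)"
    unfolding d_def mass_def using integrable_softmax by auto
  then have "AE x in M. d x = 0"
    using integral_nonneg_eq_0_iff_AE[of M d] d(1) assms by simp
  then have "AE x in M. \<exists>a. q - p = vec a"
    by (rule eventually_mono) (rule d(2))
  then show ?thesis by simp
qed

lemma mass_monotone: "0 \<le> (mass q s - mass p s) \<bullet> (q - p)"
proof -
  have "(mass q s - mass p s) \<bullet> (q - p)
     = (\<integral>x. (softmax (q - s *\<^sub>R C x) - softmax (p - s *\<^sub>R C x)) \<bullet> (q - p) \<partial>M)"
    unfolding mass_def using integrable_softmax by auto
  also have "\<dots> \<ge> 0"
  proof (rule Bochner_Integration.integral_nonneg)
    show "0 \<le> (softmax (q - s *\<^sub>R C x) - softmax (p - s *\<^sub>R C x)) \<bullet> (q - p)" for x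
      using softmax_monotone(1)[of "q - s *\<^sub>R C x" "p - s *\<^sub>R C x"] by simp
  qed
  finally show ?thesis .
qed

lemma zero_sum_vecD:
  fixes q p :: "real^'k"
  assumes "(\<Sum>k\<in>UNIV. q $ k) = (\<Sum>k\<in>UNIV. p $ k)" "q - p = vec a"
  shows "q = p"
proof -
  have "(\<Sum>k\<in>UNIV. (q - p) $ k) = 0" using assms(1) by (simp add: sum_subtractf)
  then have "a = 0" unfolding assms(2) by simp
  then show ?thesis using assms(2) by (simp add: vec_eq_iff)
qed

lemma minimiser_imp_mass:
  assumes "\<And>p. dual q s \<le> dual p s"
  shows "mass q s = \<mu>"
proof -
  have "(\<lambda>h. (mass q s - \<mu>) \<bullet> h) = (\<lambda>h. 0)"
    by (rule has_derivative_local_min[OF has_derivative_dual]) (simp add: assms)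
  then have "(mass q s - \<mu>) \<bullet> (mass q s - \<mu>) = 0" by metis
  then show ?thesis by simp
qed

lemma ex1_optimal: "\<exists>!q. (\<Sum>k\<in>UNIV. q $ k) = 0 \<and> mass q s = \<mu>"
proof -
  obtain q where q: "(\<Sum>k\<in>UNIV. q $ k) = 0" "\<And>p. dual q s \<le> dual p s"
    using ex_zero_sum_minimiser[of s] by blast
  then have "mass q s = \<mu>" by (intro minimiser_imp_mass)
  with q(1) show ?thesis
    using mass_strictly_monotone[of _ s] zero_sum_vecD by (metis diff_self inner_zero_left)
qed

definition optimal :: "real \<Rightarrow> real^'k" where
  "optimal s = (THE q. (\<Sum>k\<in>UNIV. q $ k) = 0 \<and> mass q s = \<mu>)"

lemma optimal: "(\<Sum>k\<in>UNIV. optimal s $ k) = 0" "mass (optimal s) s = \<mu>"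
  using theI'[OF ex1_optimal] unfolding optimal_def by auto

lemma optimal_eqI: "(\<Sum>k\<in>UNIV. q $ k) = 0 \<Longrightarrow> mass q s = \<mu> \<Longrightarrow> q = optimal s"
  using ex1_optimal optimal by blast

lemma minimiser_iff:
  assumes "(\<Sum>k\<in>UNIV. q $ k) = 0"
  shows "(\<forall>p. dual q s \<le> dual p s) \<longleftrightarrow> q = optimal s"
proof -
  obtain q' where q': "(\<Sum>k\<in>UNIV. q' $ k) = 0" "\<And>p. dual q' s \<le> dual p s"
    using ex_zero_sum_minimiser[of s] by blast
  then have "q' = optimal s"
    by (intro optimal_eqI minimiser_imp_mass)
  then show ?thesis
    using q' assms minimiser_imp_mass optimal_eqI by metis
qed

end

section \<open>Differentiability of the optimal potential\<close>

text \<open>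
  The graph map \<open>(x,t) \<mapsto> (F(x,t), t)\<close> is injective with invertible derivative, so its inverse is
  differentiable at \<open>(0,t)\<close>; the curve \<open>u\<close> is the first component of that inverse on \<open>{0} \<times> \<real>\<close>.
\<close>

lemma implicit_function_derivative:
  fixes F :: "'a::euclidean_space \<times> real \<Rightarrow> 'a" and u :: "real \<Rightarrow> 'a"
  assumes deriv: "\<And>p. (F has_derivative F' p) (at p)"
    and inj: "\<And>x y t. F (x, t) = F (y, t) \<Longrightarrow> x = y"
    and zero: "\<And>t. F (u t, t) = 0"
    and nondeg: "\<And>h. F' (u t, t) (h, 0) = 0 \<Longrightarrow> h = 0"
  shows "\<exists>v. (u has_vector_derivative v) (at t) \<and> F' (u t, t) (v, 1) = 0"
proof -
  let ?p = "(u t, t)"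
  define A where "A h = F' ?p (h, 0)" for h
  define b where "b = F' ?p (0, 1)"
  have lin: "linear (F' ?p)"
    using deriv has_derivative_linear by blast
  have split: "F' ?p (h, r) = A h + r *\<^sub>R b" for h r
    using linear_add[OF lin, of "(h, 0)" "(0, r)"] linear_scale[OF lin, of r "(0, 1)"]
    by (simp add: A_def b_def)
  have "linear A"
    using linear_add[OF lin, of "(_, 0)" "(_, 0)"] linear_scale[OF lin, of _ "(_, 0)"]
    by (intro linearI) (auto simp: A_def)
  moreover have "inj A"
    using nondeg \<open>linear A\<close> by (simp add: linear_injective_0 A_def)
  ultimately obtain B where B: "linear B" "\<And>x. A (B x) = x"
    using linear_injective_isomorphism by metis
  define \<Psi> where "\<Psi> p = (F p, snd p)" for p
  have "inj \<Psi>"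
    using inj by (auto simp: inj_on_def \<Psi>_def)
  \<comment> \<open>Solve \<open>A h + r b = w\<close> for \<open>h\<close>.\<close>
  define g' where "g' w = (B (fst w - snd w *\<^sub>R b), snd w)" for w :: "'a \<times> real"
  have "(inv \<Psi> has_derivative g') (at (\<Psi> ?p))"
  proof (rule has_derivative_inverse_strong[where f = \<Psi> and x = ?p and S = UNIV and f' = "\<lambda>h. (F' ?p h, snd h)"])
    show "continuous_on UNIV \<Psi>"
      unfolding \<Psi>_def
      using deriv by (intro continuous_intros continuous_at_imp_continuous_on)
        (auto intro: has_derivative_continuous)
    show "(\<Psi> has_derivative (\<lambda>h. (F' ?p h, snd h))) (at ?p)"
      unfolding \<Psi>_def
      by (intro has_derivative_Pair deriv bounded_linear_imp_has_derivative bounded_linear_snd)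
    show "(\<lambda>h. (F' ?p h, snd h)) \<circ> g' = id"
      using B by (auto simp: g'_def split fun_eq_iff)
  qed (use \<open>inj \<Psi>\<close> in auto)
  then have "(inv \<Psi> has_derivative g') (at (0, t))"
    by (simp add: \<Psi>_def zero)
  then have "((\<lambda>\<tau>. fst (inv \<Psi> (0, \<tau>))) has_derivative (\<lambda>r. fst (g' (0, r)))) (at t)"
    by (rule has_derivative_fst[OF has_derivative_compose
          [OF has_derivative_Pair[OF has_derivative_const has_derivative_ident]]])
  moreover have "fst (inv \<Psi> (0, \<tau>)) = u \<tau>" for \<tau>
  proof -
    have "\<Psi> (u \<tau>, \<tau>) = (0, \<tau>)" by (simp add: \<Psi>_def zero)
    then show ?thesis using \<open>inj \<Psi>\<close> by (metis fst_conv inv_f_f)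
  qed
  moreover have "fst (g' (0, r)) = r *\<^sub>R B (- b)" for r
    using linear_scale[OF B(1), of r "- b"] by (simp add: g'_def)
  ultimately have "(u has_vector_derivative B (- b)) (at t)"
    by (simp add: has_vector_derivative_def)
  moreover have "F' ?p (B (- b), 1) = 0"
    by (simp add: split B(2))
  ultimately show ?thesis by blast
qed

context soft_transport
begin

text \<open>
  \<open>h \<bullet> mass_deriv p (h, 0)\<close> is the integral over \<open>x\<close> of variances of \<open>h\<close>.
\<close>

lemma mass_deriv_nonneg: "0 \<le> h \<bullet> mass_deriv p (h, 0)"
  and mass_deriv_eq_0D: "h \<bullet> mass_deriv p (h, 0) = 0 \<Longrightarrow> \<exists>a. h = vec a"
proof -
  define d where "d = (\<lambda>x. h \<bullet> softmax_deriv (fst p - snd p *\<^sub>R C x) h)"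
  have d: "0 \<le> d x" "d x = 0 \<Longrightarrow> \<exists>a. h = vec a" for x
    using softmax_deriv_nonneg softmax_deriv_eq_0D unfolding d_def by blast+
  have int: "integrable M d" "integral\<^sup>L M d = h \<bullet> mass_deriv p (h, 0)"
    using integrable_softmax_deriv[of p "(h, 0)"] by (auto simp: d_def mass_deriv_def)
  show "0 \<le> h \<bullet> mass_deriv p (h, 0)"
    using d(1) by (simp flip: int(2))
  assume "h \<bullet> mass_deriv p (h, 0) = 0"
  then have "AE x in M. d x = 0"
    using integral_nonneg_eq_0_iff_AE[of M d] d(1) int by simp
  then have "AE x in M. \<exists>a. h = vec a"
    by (rule eventually_mono) (rule d(2))
  then show "\<exists>a. h = vec a" by simp
qed

text \<open>
  The derivative of \<open>mass\<close> kills constant vectors.  The added term pins the constant: it vanishes on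
  zero-sum vectors and makes the derivative in \<open>q\<close> invertible.
\<close>

definition pinned_deriv :: "(real^'k) \<times> real \<Rightarrow> (real^'k) \<times> real \<Rightarrow> real^'k" where
  "pinned_deriv p h = mass_deriv p h + vec (\<Sum>k\<in>UNIV. fst h $ k)"

lemma inner_vec_sum: "vec a \<bullet> (h::real^'k) = a * (\<Sum>k\<in>UNIV. h $ k)"
  by (simp add: inner_vec_def sum_distrib_left)

text \<open>
  Pairing with \<open>h\<close> gives an averaged variance plus a square: the first forces \<open>h\<close> to be constant, the
  second forces its sum to vanish.
\<close>

lemma pinned_deriv_nondegenerate:
  assumes "pinned_deriv p (h, 0) = 0"
  shows "h = 0"
proof -
  have "h \<bullet> mass_deriv p (h, 0) + (\<Sum>k\<in>UNIV. h $ k)\<^sup>2 = h \<bullet> pinned_deriv p (h, 0)"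
    by (simp add: pinned_deriv_def inner_add_right inner_commute[of h "vec _"] inner_vec_sum
        power2_eq_square)
  also have "\<dots> = 0" by (simp add: assms)
  finally have "h \<bullet> mass_deriv p (h, 0) = 0" "(\<Sum>k\<in>UNIV. h $ k) = 0"
    using mass_deriv_nonneg[of h p] zero_le_power2[of "\<Sum>k\<in>UNIV. h $ k"]
    by (smt (verit) zero_eq_power2)+
  then show ?thesis
    using mass_deriv_eq_0D[of h p] zero_sum_vecD[of h 0] by auto
qed

lemma optimal_has_derivative:
  "\<exists>v. (optimal has_vector_derivative v) (at s) \<and> pinned_deriv (optimal s, s) (v, 1) = 0"
proof (rule implicit_function_derivative
    [where F = "\<lambda>p. mass (fst p) (snd p) - \<mu> + vec (\<Sum>k\<in>UNIV. fst p $ k)"])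
  have "bounded_linear (\<lambda>p::(real^'k) \<times> real. vec (\<Sum>k\<in>UNIV. fst p $ k) :: real^'k)"
    unfolding linear_conv_bounded_linear[symmetric]
    by (rule linearI) (auto simp: vec_eq_iff sum.distrib sum_distrib_left)
  then show "((\<lambda>p. mass (fst p) (snd p) - \<mu> + vec (\<Sum>k\<in>UNIV. fst p $ k))
      has_derivative pinned_deriv p) (at p)" for p
    unfolding pinned_deriv_def[abs_def]
    by (intro has_derivative_add bounded_linear_imp_has_derivative
        has_derivative_diff[OF has_derivative_mass has_derivative_const, simplified])
next
  fix q p s
  assume eq: "mass (fst (q, s)) (snd (q, s)) - \<mu> + vec (\<Sum>k\<in>UNIV. fst (q, s) $ k)
    = mass (fst (p, s)) (snd (p, s)) - \<mu> + vec (\<Sum>k\<in>UNIV. fst (p, s) $ k)"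
  let ?S = "\<Sum>k\<in>UNIV. (q - p) $ k"
  have "mass q s - mass p s = - vec ?S"
    using eq by (simp add: vec_eq_iff sum_subtractf algebra_simps)
  then have "(mass q s - mass p s) \<bullet> (q - p) = - ?S\<^sup>2"
    by (simp add: inner_vec_sum power2_eq_square del: vector_minus_component)
  \<comment> \<open>By monotonicity the pairing is nonnegative, yet it equals minus a square.\<close>
  moreover from this have "?S\<^sup>2 = 0"
    using mass_monotone[of q s p] zero_le_power2[of ?S] by linarith
  ultimately show "q = p"
    using mass_strictly_monotone[of q s p] zero_sum_vecD[of q p] by (auto simp: sum_subtractf)
qed (use optimal pinned_deriv_nondegenerate in auto)

lemma mass_deriv_nth:
  "mass_deriv p h $ i = (\<integral>x. softmax_deriv (fst p - snd p *\<^sub>R C x) (fst h - snd h *\<^sub>R C x) $ i \<partial>M)"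
  unfolding mass_deriv_def
  by (rule integral_bounded_linear[OF bounded_linear_vec_nth integrable_softmax_deriv, symmetric])

lemma linear_pinned_deriv: "linear (\<lambda>h. pinned_deriv p (h, 0))"
proof -
  have "linear (mass_deriv p)"
    using has_derivative_mass has_derivative_linear by blast
  from linear_add[OF this, of "(_, 0)" "(_, 0)"] linear_scale[OF this, of _ "(_, 0)"]
  show ?thesis
    by (intro linearI) (auto simp: pinned_deriv_def vec_eq_iff sum.distrib sum_distrib_left algebra_simps)
qed

text \<open>
  Entries of the matrix of \<open>pinned_deriv p (_, 0)\<close> and of the vector \<open>- pinned_deriv p (0, 1)\<close>, so that
  the derivative \<open>v\<close> of \<open>optimal\<close> solves the linear system \<open>hess *v v = drift\<close>.
\<close>

definition hess_entry :: "(real^'k) \<times> real \<Rightarrow> 'k \<Rightarrow> 'k \<Rightarrow> real" where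
  "hess_entry p i j = (\<integral>x. softmax (fst p - snd p *\<^sub>R C x) $ i *
     ((if i = j then 1 else 0) - softmax (fst p - snd p *\<^sub>R C x) $ j) \<partial>M) + 1"

definition drift_entry :: "(real^'k) \<times> real \<Rightarrow> 'k \<Rightarrow> real" where
  "drift_entry p i = (\<integral>x. softmax (fst p - snd p *\<^sub>R C x) $ i *
     (C x $ i - (\<Sum>j\<in>UNIV. softmax (fst p - snd p *\<^sub>R C x) $ j * C x $ j)) \<partial>M)"

lemma matrix_pinned_deriv: "matrix (\<lambda>h. pinned_deriv p (h, 0)) = (\<chi> i j. hess_entry p i j)"
proof -
  have "pinned_deriv p (axis j 1, 0) $ i = hess_entry p i j" for i j
  proof -
    have "(\<Sum>k\<in>UNIV. axis j 1 $ k) = (1::real)" "axis j (1::real) $ i = (if i = j then 1 else 0)"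
      by (simp_all add: axis_def)
    then show ?thesis
      by (simp add: pinned_deriv_def mass_deriv_nth hess_entry_def softmax_deriv_def inner_axis)
  qed
  then show ?thesis by (simp add: matrix_def vec_eq_iff)
qed

lemma pinned_deriv_matrix: "pinned_deriv p (h, 0) = (\<chi> i j. hess_entry p i j) *v h"
  using fun_cong[OF matrix_vector_mul(2)[OF linear_pinned_deriv], where x = h] by (simp add: matrix_pinned_deriv)

lemma det_hess_nz: "det (\<chi> i j. hess_entry p i j) \<noteq> 0"
  unfolding matrix_pinned_deriv[symmetric] det_nz_iff_inj[OF linear_pinned_deriv]
    linear_injective_0[OF linear_pinned_deriv]
  using pinned_deriv_nondegenerate by blast

lemma pinned_deriv_drift: "pinned_deriv p (0, 1) = - (\<chi> i. drift_entry p i)"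
proof -
  have "pinned_deriv p (0, 1) $ i = - drift_entry p i" for i
  proof -
    have "pinned_deriv p (0, 1) $ i = (\<integral>x. - (softmax (fst p - snd p *\<^sub>R C x) $ i *
       (C x $ i - (\<Sum>j\<in>UNIV. softmax (fst p - snd p *\<^sub>R C x) $ j * C x $ j))) \<partial>M)"
      unfolding pinned_deriv_def vector_add_component mass_deriv_nth
      by (simp add: softmax_deriv_def inner_vec_def sum_negf algebra_simps)
    then show ?thesis by (simp add: drift_entry_def)
  qed
  then show ?thesis by (simp add: vec_eq_iff)
qed

text \<open>
  Cramer's rule rather than an inverse matrix: determinants are polynomials in the entries, so the
  derivative is visibly built from integrals by ring operations and one reciprocal.
\<close>

lemma optimal_has_derivative_cramer:
  fixes s :: real
  defines "p \<equiv> (optimal s, s)"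
  shows "((\<lambda>s. optimal s $ k) has_real_derivative
    det (\<chi> i j. if j = k then drift_entry p i else hess_entry p i j) / det (\<chi> i j. hess_entry p i j)) (at s)"
proof -
  let ?A = "\<chi> i j. hess_entry p i j" and ?b = "\<chi> i. drift_entry p i"
  obtain v where v: "(optimal has_vector_derivative v) (at s)" "pinned_deriv p (v, 1) = 0"
    using optimal_has_derivative unfolding p_def by blast
  have "linear (mass_deriv p)"
    using has_derivative_mass has_derivative_linear by blast
  from linear_add[OF this, of "(v, 0)" "(0, 1)"]
  have "pinned_deriv p (v, 1) = pinned_deriv p (v, 0) + pinned_deriv p (0, 1)"
    by (simp add: pinned_deriv_def)
  then have "?A *v v = ?b"
    using v(2) by (simp add: pinned_deriv_matrix pinned_deriv_drift)
  then have "v $ k = det (\<chi> i j. if j = k then drift_entry p i else hess_entry p i j) / det ?A"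
    using cramer[OF det_hess_nz[of p], of v ?b] by (simp cong: if_cong)
  moreover have "((\<lambda>s. optimal s $ k) has_real_derivative v $ k) (at s)"
    using bounded_linear.has_vector_derivative[OF bounded_linear_vec_nth v(1)]
    by (simp add: has_real_derivative_iff_has_vector_derivative)
  ultimately show ?thesis by simp
qed

end

section \<open>An algebra of smooth parameter integrals\<close>

text \<open>
  A class of functions that is stable under differentiation consists of smooth functions: iterate.
\<close>

lemma smooth_on_coinduct:
  fixes f :: "real \<Rightarrow> 'a::real_normed_vector"
  assumes "P f"
    and step: "\<And>f. P f \<Longrightarrow> \<exists>g. P g \<and> (\<forall>t\<in>S. (f has_vector_derivative g t) (at t within S))"
  shows "smooth_on S f"
proof -
  have "\<exists>D. \<forall>n. (P (D n) \<and> (n = 0 \<longrightarrow> D n = f)) \<and>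
      (\<forall>t\<in>S. (D n has_vector_derivative D (Suc n) t) (at t within S))"
    using \<open>P f\<close> step by (intro dependent_nat_choice) auto
  then obtain D where "D 0 = f"
    "\<And>n t. t \<in> S \<Longrightarrow> (D n has_vector_derivative D (Suc n) t) (at t within S)"
    by blast
  then show ?thesis unfolding smooth_on_def by (intro exI[of _ D]) simp
qed

text \<open>
  Functions of a parameter \<open>t\<close> and a state \<open>x\<close>.  The reciprocal requires \<open>f\<close> to be bounded away from
  zero near each \<open>t\<close>, uniformly in \<open>x\<close>: this keeps all members locally bounded uniformly in \<open>x\<close>, which is
  what differentiation under the integral needs.  The result of an integration is regarded as a
  function that is constant in \<open>x\<close>.
\<close>

inductive leibniz_algebra :: "'a measure \<Rightarrow> real set \<Rightarrow> (real \<Rightarrow> real) set \<Rightarrow> (real \<Rightarrow> 'a \<Rightarrow> real) \<Rightarrow> bool"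
  for M T G where
  gen: "g \<in> G \<Longrightarrow> leibniz_algebra M T G (\<lambda>t x. g t)"
| state: "f \<in> borel_measurable M \<Longrightarrow> (\<And>x. x \<in> space M \<Longrightarrow> \<bar>f x\<bar> \<le> B) \<Longrightarrow> leibniz_algebra M T G (\<lambda>t x. f x)"
| add: "leibniz_algebra M T G f \<Longrightarrow> leibniz_algebra M T G g \<Longrightarrow> leibniz_algebra M T G (\<lambda>t x. f t x + g t x)"
| mult: "leibniz_algebra M T G f \<Longrightarrow> leibniz_algebra M T G g \<Longrightarrow> leibniz_algebra M T G (\<lambda>t x. f t x * g t x)"
| exp: "leibniz_algebra M T G f \<Longrightarrow> leibniz_algebra M T G (\<lambda>t x. exp (f t x))"
| inverse: "leibniz_algebra M T G f \<Longrightarrow>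
    (\<And>t. t \<in> T \<Longrightarrow> \<exists>e>0. \<forall>\<^sub>F u in nhds t. \<forall>x\<in>space M. e \<le> \<bar>f u x\<bar>) \<Longrightarrow>
    leibniz_algebra M T G (\<lambda>t x. inverse (f t x))"
| integral: "leibniz_algebra M T G f \<Longrightarrow> leibniz_algebra M T G (\<lambda>t x. \<integral>z. f t z \<partial>M)"

locale leibniz_generators = prob_space M for M :: "'a measure" +
  fixes T :: "real set" and G :: "(real \<Rightarrow> real) set"
  assumes open_T: "open T"
    and cont_G: "\<And>g t. g \<in> G \<Longrightarrow> t \<in> T \<Longrightarrow> isCont g t"
begin

abbreviation alg :: "(real \<Rightarrow> 'a \<Rightarrow> real) \<Rightarrow> bool" where
  "alg \<equiv> leibniz_algebra M T G"

lemmas alg_intros = leibniz_algebra.intros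

lemma alg_measurable: "alg f \<Longrightarrow> f t \<in> borel_measurable M"
  by (induction arbitrary: t rule: leibniz_algebra.induct) simp_all

text \<open>
  Local bounds and continuity go through the induction together, because continuity of an integral
  follows from dominated convergence with the local bound as majorant.
\<close>

lemma alg_tame:
  assumes "alg f" "t \<in> T"
  shows "(\<exists>B. \<forall>\<^sub>F u in nhds t. \<forall>x\<in>space M. \<bar>f u x\<bar> \<le> B) \<and> (\<forall>x\<in>space M. isCont (\<lambda>u. f u x) t)"
  using assms
proof (induction rule: leibniz_algebra.induct)
  case (gen g)
  then have "isCont g t" by (rule cont_G)
  then have "\<forall>\<^sub>F u in nhds t. dist (g u) (g t) < 1"
    by (simp add: isCont_def tendsto_iff eventually_nhds_conv_at)
  then have "\<forall>\<^sub>F u in nhds t. \<bar>g u\<bar> \<le> \<bar>g t\<bar> + 1"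
    by (rule eventually_mono) (auto simp: dist_real_def)
  with \<open>isCont g t\<close> show ?case by (auto intro: eventually_mono)
next
  case (state f B)
  then show ?case by (auto intro!: exI[of _ B] always_eventually)
next
  case (add f g)
  then obtain A B where "\<forall>\<^sub>F u in nhds t. \<forall>x\<in>space M. \<bar>f u x\<bar> \<le> A" "\<forall>\<^sub>F u in nhds t. \<forall>x\<in>space M. \<bar>g u x\<bar> \<le> B"
    by blast
  then have "\<forall>\<^sub>F u in nhds t. \<forall>x\<in>space M. \<bar>f u x + g u x\<bar> \<le> A + B"
    by eventually_elim (auto intro!: order_trans[OF abs_triangle_ineq add_mono])
  moreover have "\<forall>x\<in>space M. isCont (\<lambda>u. f u x + g u x) t"
    by (intro ballI continuous_add) (use add in blast)+
  ultimately show ?case by blast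
next
  case (mult f g)
  then obtain A B where "\<forall>\<^sub>F u in nhds t. \<forall>x\<in>space M. \<bar>f u x\<bar> \<le> A" "\<forall>\<^sub>F u in nhds t. \<forall>x\<in>space M. \<bar>g u x\<bar> \<le> B"
    by blast
  then have "\<forall>\<^sub>F u in nhds t. \<forall>x\<in>space M. \<bar>f u x * g u x\<bar> \<le> A * B"
    by eventually_elim (auto simp: abs_mult intro!: mult_mono')
  moreover have "\<forall>x\<in>space M. isCont (\<lambda>u. f u x * g u x) t"
    by (intro ballI continuous_mult) (use mult in blast)+
  ultimately show ?case by blast
next
  case (exp f)
  then obtain B where "\<forall>\<^sub>F u in nhds t. \<forall>x\<in>space M. \<bar>f u x\<bar> \<le> B"
    by blast
  then have "\<forall>\<^sub>F u in nhds t. \<forall>x\<in>space M. \<bar>exp (f u x)\<bar> \<le> exp B"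
    by eventually_elim auto
  moreover have "\<forall>x\<in>space M. isCont (\<lambda>u. exp (f u x)) t"
    by (intro ballI continuous_exp) (use exp in blast)
  ultimately show ?case by blast
next
  case (inverse f)
  then obtain e where e: "e > 0" "\<forall>\<^sub>F u in nhds t. \<forall>x\<in>space M. e \<le> \<bar>f u x\<bar>"
    by blast
  then have "\<forall>\<^sub>F u in nhds t. \<forall>x\<in>space M. \<bar>inverse (f u x)\<bar> \<le> inverse e"
    by (auto elim!: eventually_mono simp: le_imp_inverse_le)
  moreover have "f t x \<noteq> 0" if "x \<in> space M" for x
    using eventually_nhds_x_imp_x[OF e(2)] e(1) that by fastforce
  then have "\<forall>x\<in>space M. isCont (\<lambda>u. inverse (f u x)) t"
    by (intro ballI continuous_at_within_inverse) (use inverse in blast)+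
  ultimately show ?case by blast
next
  case (integral f)
  then obtain B where B: "\<forall>\<^sub>F u in nhds t. \<forall>x\<in>space M. \<bar>f u x\<bar> \<le> B"
    by blast
  have "\<bar>\<integral>x. f u x \<partial>M\<bar> \<le> B" if "\<forall>x\<in>space M. \<bar>f u x\<bar> \<le> B" for u
  proof -
    have "integrable M (f u)"
      by (rule integrable_const_bound[of _ B])
         (use that alg_measurable[OF integral(1)] in auto)
    then have "\<bar>\<integral>x. f u x \<partial>M\<bar> \<le> (\<integral>x. B \<partial>M)"
      using that by (intro order_trans[OF integral_abs_bound integral_mono]) auto
    then show ?thesis by (simp add: prob_space)
  qed
  then have "\<forall>\<^sub>F u in nhds t. \<bar>\<integral>x. f u x \<partial>M\<bar> \<le> B"
    using B by (rule eventually_mono[rotated])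
  moreover have "((\<lambda>u. \<integral>x. f u x \<partial>M) \<longlongrightarrow> (\<integral>x. f t x \<partial>M)) (at t)"
    unfolding tendsto_at_iff_sequentially comp_def
  proof (intro allI impI)
    fix S assume S: "\<forall>i. S i \<in> UNIV - {t}" "S \<longlonglongrightarrow> t"
    obtain N where N: "\<And>i. i \<ge> N \<Longrightarrow> \<forall>x\<in>space M. \<bar>f (S i) x\<bar> \<le> B"
      using eventually_compose_filterlim[OF B S(2)] by (auto simp: eventually_sequentially)
    have "(\<lambda>i. \<integral>x. f (S (i + N)) x \<partial>M) \<longlonglongrightarrow> (\<integral>x. f t x \<partial>M)"
    proof (rule integral_dominated_convergence[where w = "\<lambda>_. B"])
      show "AE x in M. (\<lambda>i. f (S (i + N)) x) \<longlonglongrightarrow> f t x"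
      proof (rule AE_I2)
        fix x assume "x \<in> space M"
        then have "isCont (\<lambda>u. f u x) t" using integral by blast
        then show "(\<lambda>i. f (S (i + N)) x) \<longlonglongrightarrow> f t x"
          using S(2) by (intro isCont_tendsto_compose[of t "\<lambda>u. f u x"] LIMSEQ_ignore_initial_segment)
      qed
    qed (use alg_measurable[OF integral(1)] N in auto)
    then show "(\<lambda>i. \<integral>x. f (S i) x \<partial>M) \<longlonglongrightarrow> (\<integral>x. f t x \<partial>M)"
      by (rule LIMSEQ_offset)
  qed
  ultimately show ?case by (auto simp: isCont_def)
qed

lemma alg_const: "alg (\<lambda>t x. a)"
  by (rule alg_intros(2)[of _ _ "\<bar>a\<bar>"]) auto

lemma alg_minus: "alg f \<Longrightarrow> alg (\<lambda>t x. - f t x)"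
  using alg_intros(4)[OF alg_const[of "-1"]] by simp

lemma alg_diff: "alg f \<Longrightarrow> alg g \<Longrightarrow> alg (\<lambda>t x. f t x - g t x)"
  using alg_intros(3)[OF _ alg_minus] by simp

lemma alg_sum: "(\<And>i. i \<in> I \<Longrightarrow> alg (f i)) \<Longrightarrow> alg (\<lambda>t x. \<Sum>i\<in>I. f i t x)"
proof (induction I rule: infinite_finite_induct)
  case (insert i I)
  then have "alg (\<lambda>t x. f i t x + (\<Sum>i\<in>I. f i t x))" by (intro alg_intros(3)) auto
  with insert show ?case by simp
qed (auto intro: alg_const)

lemma alg_prod: "(\<And>i. i \<in> I \<Longrightarrow> alg (f i)) \<Longrightarrow> alg (\<lambda>t x. \<Prod>i\<in>I. f i t x)"
proof (induction I rule: infinite_finite_induct)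
  case (insert i I)
  then have "alg (\<lambda>t x. f i t x * (\<Prod>i\<in>I. f i t x))" by (intro alg_intros(4)) auto
  with insert show ?case by simp
qed (auto intro: alg_const)

lemma alg_det:
  fixes A :: "'k::finite \<Rightarrow> 'k \<Rightarrow> real \<Rightarrow> 'a \<Rightarrow> real"
  assumes "\<And>i j. alg (A i j)"
  shows "alg (\<lambda>t x. det (\<chi> i j. A i j t x))"
  unfolding det_def vec_lambda_beta by (intro alg_sum alg_intros(4) alg_prod alg_const assms)

lemma alg_inverse_state_free:
  assumes "alg (\<lambda>t x. f t)" "\<And>t. t \<in> T \<Longrightarrow> f t \<noteq> 0"
  shows "alg (\<lambda>t x. inverse (f t))"
proof (rule alg_intros(6)[OF assms(1)])
  fix t assume t: "t \<in> T"
  then have "isCont f t"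
    using alg_tame[OF assms(1) t] not_empty by blast
  then have "\<forall>\<^sub>F u in nhds t. \<bar>f t\<bar> / 2 < \<bar>f u\<bar>"
    using assms(2)[OF t]
    by (intro order_tendstoD(1)[OF tendsto_rabs]) (auto simp: isCont_def tendsto_at_iff_tendsto_nhds)
  then show "\<exists>e>0. \<forall>\<^sub>F u in nhds t. \<forall>x\<in>space M. e \<le> \<bar>f u\<bar>"
    using assms(2)[OF t] by (intro exI[of _ "\<bar>f t\<bar> / 2"]) (auto elim!: eventually_mono)
qed

lemma alg_integral_deriv:
  assumes "alg f" "alg D" and t: "t \<in> T"
    and deriv: "\<And>t x. t \<in> T \<Longrightarrow> x \<in> space M \<Longrightarrow> ((\<lambda>u. f u x) has_real_derivative D t x) (at t)"
  shows "((\<lambda>u. \<integral>x. f u x \<partial>M) has_real_derivative (\<integral>x. D t x \<partial>M)) (at t)"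
proof -
  obtain A B where "\<forall>\<^sub>F u in nhds t. \<forall>x\<in>space M. \<bar>f u x\<bar> \<le> A" "\<forall>\<^sub>F u in nhds t. \<forall>x\<in>space M. \<bar>D u x\<bar> \<le> B"
    using alg_tame assms by meson
  moreover have "\<forall>\<^sub>F u in nhds t. u \<in> T"
    using open_T t by (rule eventually_nhds_in_open)
  ultimately have "\<forall>\<^sub>F u in nhds t. u \<in> T \<and> (\<forall>x\<in>space M. \<bar>f u x\<bar> \<le> A) \<and> (\<forall>x\<in>space M. \<bar>D u x\<bar> \<le> B)"
    by eventually_elim auto
  then obtain e where e: "e > 0" "\<And>u. u \<in> ball t e \<Longrightarrow> u \<in> T"
    "\<And>u x. u \<in> ball t e \<Longrightarrow> x \<in> space M \<Longrightarrow> \<bar>f u x\<bar> \<le> A"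
    "\<And>u x. u \<in> ball t e \<Longrightarrow> x \<in> space M \<Longrightarrow> \<bar>D u x\<bar> \<le> B"
    unfolding eventually_nhds_metric by (auto simp: dist_commute)
  have "((\<lambda>u. \<integral>x. f u x \<partial>M) has_derivative (\<lambda>h. \<integral>x. D t x * h \<partial>M)) (at t)"
  proof (rule has_derivative_integral_bounded[where e = e and K = "\<bar>B\<bar>" and f' = "\<lambda>u x h. D u x * h"])
    show "integrable M (f u)" if "u \<in> ball t e" for u
      by (rule integrable_const_bound[of _ A]) (use e(3)[OF that] alg_measurable[OF assms(1)] in auto)
    show "(\<lambda>x. D t x * h) \<in> borel_measurable M" for h
      using alg_measurable[OF assms(2)] by measurable
    show "norm (D u x * h) \<le> \<bar>B\<bar> * norm h" if "u \<in> ball t e" "x \<in> space M" for u x h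
      using e(4)[OF that] by (auto simp: abs_mult intro!: mult_right_mono)
    show "((\<lambda>u. f u x) has_derivative (*) (D u x)) (at u)" if "u \<in> ball t e" "x \<in> space M" for u x
      using deriv[OF e(2)[OF that(1)] that(2)] by (simp add: has_field_derivative_def)
  qed (use e(1) finite_measure_axioms in auto)
  moreover have "(\<integral>x. D t x * h \<partial>M) = (\<integral>x. D t x \<partial>M) * h" for h
    by simp
  ultimately show ?thesis
    by (simp add: has_field_derivative_def)
qed

text \<open>
  Stability of the algebra under \<open>d/dt\<close> follows from stability for the generators.  Derivatives of
  integrands lie in the algebra and hence are locally bounded, which justifies differentiating under
  the integral.
\<close>

lemma alg_deriv:
  assumes gen_deriv: "\<And>g. g \<in> G \<Longrightarrow> \<exists>D. alg D \<and> (\<forall>t\<in>T. \<forall>x\<in>space M. (g has_real_derivative D t x) (at t))"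
    and "alg f"
  shows "\<exists>D. alg D \<and> (\<forall>t\<in>T. \<forall>x\<in>space M. ((\<lambda>u. f u x) has_real_derivative D t x) (at t))"
  using assms(2)
proof (induction rule: leibniz_algebra.induct)
  case (gen g)
  then show ?case using gen_deriv by blast
next
  case (state f B)
  show ?case by (intro exI[of _ "\<lambda>_ _. 0"]) (auto intro: alg_const)
next
  case (add f g)
  then obtain D E where "alg D" "\<forall>t\<in>T. \<forall>x\<in>space M. ((\<lambda>u. f u x) has_real_derivative D t x) (at t)"
    "alg E" "\<forall>t\<in>T. \<forall>x\<in>space M. ((\<lambda>u. g u x) has_real_derivative E t x) (at t)" by blast
  then show ?case
    by (intro exI[of _ "\<lambda>t x. D t x + E t x"]) (auto intro!: alg_intros(3) DERIV_add)
next
  case (mult f g)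
  then obtain D E where "alg D" "\<forall>t\<in>T. \<forall>x\<in>space M. ((\<lambda>u. f u x) has_real_derivative D t x) (at t)"
    "alg E" "\<forall>t\<in>T. \<forall>x\<in>space M. ((\<lambda>u. g u x) has_real_derivative E t x) (at t)" by blast
  with mult(1,2) show ?case
    by (intro exI[of _ "\<lambda>t x. D t x * g t x + E t x * f t x"])
       (auto intro!: alg_intros(3,4) DERIV_mult)
next
  case (exp f)
  then obtain D where "alg D" "\<forall>t\<in>T. \<forall>x\<in>space M. ((\<lambda>u. f u x) has_real_derivative D t x) (at t)"
    by blast
  with exp(1) show ?case
    by (intro exI[of _ "\<lambda>t x. exp (f t x) * D t x"])
       (auto intro!: alg_intros(4,5) DERIV_fun_exp)
next
  case (inverse f)
  then obtain D where D: "alg D" "\<forall>t\<in>T. \<forall>x\<in>space M. ((\<lambda>u. f u x) has_real_derivative D t x) (at t)"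
    by blast
  have "f t x \<noteq> 0" if "t \<in> T" "x \<in> space M" for t x
    using eventually_nhds_x_imp_x inverse(2)[OF that(1)] that(2) by fastforce
  then have "((\<lambda>u. inverse (f u x)) has_real_derivative - (inverse (f t x) * D t x * inverse (f t x))) (at t)"
    if "t \<in> T" "x \<in> space M" for t x
    using DERIV_inverse'[of "\<lambda>u. f u x"] D(2) that by blast
  moreover have "alg (\<lambda>t x. - (inverse (f t x) * D t x * inverse (f t x)))"
    using inverse(1,2) D(1) by (intro alg_minus alg_intros(4) alg_intros(6))
  ultimately show ?case by blast
next
  case (integral f)
  then obtain D where D: "alg D" "\<forall>t\<in>T. \<forall>x\<in>space M. ((\<lambda>u. f u x) has_real_derivative D t x) (at t)"
    by blast
  then show ?case
    using alg_intros(7)[OF D(1)] alg_integral_deriv[OF integral(1) D(1)] by blast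
qed

text \<open>
  The class to iterate consists of the vector functions whose components agree on \<open>T\<close> with members of
  the algebra; agreement elsewhere would be lost under differentiation.
\<close>

lemma alg_smooth:
  fixes f :: "real \<Rightarrow> real^'k::finite"
  assumes gen_deriv: "\<And>g. g \<in> G \<Longrightarrow> \<exists>D. alg D \<and> (\<forall>t\<in>T. \<forall>x\<in>space M. (g has_real_derivative D t x) (at t))"
    and f: "\<And>k. alg (\<lambda>t x. f t $ k)"
  shows "smooth_on T f"
proof (rule smooth_on_coinduct[where P = "\<lambda>f. \<forall>k. \<exists>F. alg F \<and> (\<forall>t\<in>T. \<forall>x\<in>space M. f t $ k = F t x)"])
  show "\<forall>k. \<exists>F. alg F \<and> (\<forall>t\<in>T. \<forall>x\<in>space M. f t $ k = F t x)"
    using f by blast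
  fix f :: "real \<Rightarrow> real^'k"
  assume "\<forall>k. \<exists>F. alg F \<and> (\<forall>t\<in>T. \<forall>x\<in>space M. f t $ k = F t x)"
  then obtain F where F: "\<And>k. alg (F k)" "\<And>k t x. t \<in> T \<Longrightarrow> x \<in> space M \<Longrightarrow> f t $ k = F k t x"
    by metis
  obtain D where D: "\<And>k. alg (D k)"
    "\<And>k t x. t \<in> T \<Longrightarrow> x \<in> space M \<Longrightarrow> ((\<lambda>u. F k u x) has_real_derivative D k t x) (at t)"
    using alg_deriv[OF gen_deriv F(1)] by metis
  obtain x0 where x0: "x0 \<in> space M" using not_empty by blast
  have deriv: "((\<lambda>u. f u $ k) has_real_derivative D k t x) (at t)" if "t \<in> T" "x \<in> space M" for k t x
    by (rule has_field_derivative_transform_within_open[OF D(2)[OF that] open_T that(1)])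
       (simp add: F(2)[OF _ that(2)])
  then have unique: "D k t x = D k t x0" if "t \<in> T" "x \<in> space M" for k t x
    using DERIV_unique x0 that by blast
  have "(f has_vector_derivative (\<chi> k. D k t x0)) (at t within T)" if "t \<in> T" for t
    unfolding has_vector_derivative_def
  proof (rule has_derivative_vecI)
    fix k
    show "((\<lambda>u. f u $ k) has_derivative (\<lambda>h. (h *\<^sub>R (\<chi> k. D k t x0)) $ k)) (at t within T)"
      using has_derivative_at_withinI[OF deriv[OF that x0, unfolded has_field_derivative_def]]
      by (simp add: mult.commute[of _ "D k t x0"])
  qed
  with D(1) unique show "\<exists>g. (\<forall>k. \<exists>F. alg F \<and> (\<forall>t\<in>T. \<forall>x\<in>space M. g t $ k = F t x)) \<and>
      (\<forall>t\<in>T. (f has_vector_derivative g t) (at t within T))"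
    by (intro exI[of _ "\<lambda>t. \<chi> k. D k t x0"]) (auto intro!: exI[of _ "D _"])
qed

end

section \<open>Smoothness of the trajectory and its size\<close>

context soft_transport
begin

definition potential :: "real \<Rightarrow> real^'k" where
  "potential t = optimal (t / (1 - t))"

definition generators :: "(real \<Rightarrow> real) set" where
  "generators = insert (\<lambda>t. t) (range (\<lambda>k t. potential t $ k))"

lemma potential_has_derivative:
  assumes "t < 1"
  shows "((\<lambda>t. potential t $ k) has_real_derivative
    inverse (1 - t) * inverse (1 - t) *
    (det (\<chi> i j. if j = k then drift_entry (potential t, t / (1 - t)) i else hess_entry (potential t, t / (1 - t)) i j)
      * inverse (det (\<chi> i j. hess_entry (potential t, t / (1 - t)) i j)))) (at t)"
proof -
  have "((\<lambda>t. t / (1 - t)) has_real_derivative inverse (1 - t) * inverse (1 - t)) (at t)"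
    using assms by (auto intro!: derivative_eq_intros simp: field_simps)
  from DERIV_chain2[OF optimal_has_derivative_cramer[of k "t / (1 - t)"] this]
  show ?thesis
    unfolding potential_def by (rule DERIV_cong) (simp only: divide_inverse mult_ac)
qed

text \<open>
  The derivatives of the generators involve the generators again, through \<open>hess_entry\<close> and
  \<open>drift_entry\<close>; continuity of the generators is enough to place the reciprocal of the determinant in
  the algebra, so the argument is not circular.
\<close>

sublocale param: leibniz_generators M "{..<1}" generators
proof
  show "isCont g t" if "g \<in> generators" "t \<in> {..<1}" for g t
    using that DERIV_isCont[OF potential_has_derivative, of t] by (auto simp: generators_def)
qed auto

lemma alg_time: "param.alg (\<lambda>t x. t)"
  by (rule param.alg_intros(1)) (simp add: generators_def)

lemma alg_potential: "param.alg (\<lambda>t x. potential t $ k)"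
  by (rule param.alg_intros(1)[of "\<lambda>t. potential t $ k"]) (simp add: generators_def)

lemma alg_rate: "param.alg (\<lambda>t x. inverse (1 - t))"
  by (rule param.alg_inverse_state_free) (auto intro: param.alg_diff param.alg_const alg_time)

lemma alg_cost: "param.alg (\<lambda>t x. C x $ k)"
proof (rule param.alg_intros(2)[where B = K])
  show "\<bar>C x $ k\<bar> \<le> K" if "x \<in> space M" for x
    using component_le_norm_cart[of "C x" k] C_bound[OF that] by linarith
qed measurable

text \<open>
  Written as an exponential over a sum of exponentials, where the sum is at least one of its terms
  and hence locally bounded away from zero.
\<close>

lemma alg_softmax: "param.alg (\<lambda>t x. softmax (potential t - (t / (1 - t)) *\<^sub>R C x) $ i)"
proof -
  define z where "z k t x = potential t $ k - (t * inverse (1 - t)) * C x $ k" for k t x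
  have z: "param.alg (z k)" for k
    unfolding z_def by (intro param.alg_diff param.alg_intros(4) alg_potential alg_time alg_rate alg_cost)
  have "param.alg (\<lambda>t x. inverse (\<Sum>k\<in>UNIV. exp (z k t x)))"
  proof (rule param.alg_intros(6))
    show "param.alg (\<lambda>t x. \<Sum>k\<in>UNIV. exp (z k t x))"
      by (intro param.alg_sum param.alg_intros(5) z)
    fix t :: real assume "t \<in> {..<1}"
    then obtain B where "\<forall>\<^sub>F u in nhds t. \<forall>x\<in>space M. \<bar>z i u x\<bar> \<le> B"
      using param.alg_tame[OF z] by blast
    then have "\<forall>\<^sub>F u in nhds t. \<forall>x\<in>space M. exp (- B) \<le> \<bar>\<Sum>k\<in>UNIV. exp (z k u x)\<bar>"
    proof eventually_elim
      case (elim u)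
      show ?case
      proof
        fix x assume "x \<in> space M"
        then have "exp (- B) \<le> exp (z i u x)" using elim by (auto simp: abs_le_iff)
        also have "\<dots> \<le> (\<Sum>k\<in>UNIV. exp (z k u x))" by (rule member_le_sum) auto
        finally show "exp (- B) \<le> \<bar>\<Sum>k\<in>UNIV. exp (z k u x)\<bar>" by linarith
      qed
    qed
    then show "\<exists>e>0. \<forall>\<^sub>F u in nhds t. \<forall>x\<in>space M. e \<le> \<bar>\<Sum>k\<in>UNIV. exp (z k u x)\<bar>"
      by (intro exI[of _ "exp (- B)"]) simp
  qed
  then have "param.alg (\<lambda>t x. exp (z i t x) * inverse (\<Sum>k\<in>UNIV. exp (z k t x)))"
    by (intro param.alg_intros(4) param.alg_intros(5) z)
  then show ?thesis
    by (simp add: softmax_def z_def divide_inverse)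
qed

lemma alg_hess_entry: "param.alg (\<lambda>t x. hess_entry (potential t, t / (1 - t)) i j)"
  unfolding hess_entry_def fst_conv snd_conv
  by (intro param.alg_intros(3) param.alg_const param.alg_intros(7) param.alg_intros(4)
      param.alg_diff alg_softmax)

lemma alg_drift_entry: "param.alg (\<lambda>t x. drift_entry (potential t, t / (1 - t)) i)"
  unfolding drift_entry_def fst_conv snd_conv
  by (intro param.alg_intros(7) param.alg_intros(4) param.alg_diff param.alg_sum alg_cost alg_softmax)

lemma generators_deriv:
  assumes "g \<in> generators"
  shows "\<exists>D. param.alg D \<and> (\<forall>t\<in>{..<1}. \<forall>x\<in>space M. (g has_real_derivative D t x) (at t))"
proof -
  consider "g = (\<lambda>t. t)" | k where "g = (\<lambda>t. potential t $ k)"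
    using assms by (auto simp: generators_def)
  then show ?thesis
  proof cases
    case 1
    then show ?thesis
      by (intro exI[of _ "\<lambda>_ _. 1"]) (auto intro: param.alg_const)
  next
    case 2
    have "param.alg (\<lambda>t x. if j = k then drift_entry (potential t, t / (1 - t)) i
        else hess_entry (potential t, t / (1 - t)) i j)" for i j
      by (cases "j = k") (simp_all add: alg_drift_entry alg_hess_entry)
    then have "param.alg (\<lambda>t x. inverse (1 - t) * inverse (1 - t) *
      (det (\<chi> i j. if j = k then drift_entry (potential t, t / (1 - t)) i else hess_entry (potential t, t / (1 - t)) i j)
      * inverse (det (\<chi> i j. hess_entry (potential t, t / (1 - t)) i j))))"
      by (intro param.alg_intros(4) alg_rate param.alg_det
          param.alg_inverse_state_free[OF param.alg_det] alg_hess_entry det_hess_nz)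
    then show ?thesis
      using potential_has_derivative by (auto simp: 2)
  qed
qed

definition trajectory :: "real \<Rightarrow> real^'k" where
  "trajectory t = (1 - t) *\<^sub>R potential t"

lemma smooth_trajectory: "smooth_on {..<1} trajectory"
proof (rule param.alg_smooth[OF generators_deriv])
  have "param.alg (\<lambda>t x. (1 - t) * potential t $ k)" for k
    by (intro param.alg_intros(4) param.alg_diff param.alg_const alg_time alg_potential)
  then show "param.alg (\<lambda>t x. trajectory t $ k)" for k
    by (simp add: trajectory_def)
qed

lemma mass_zero: "mass q 0 = softmax q"
  by (simp add: mass_def prob_space)

lemma softmax_psi_init: "softmax (psi_init \<mu>) = \<mu>"
proof -
  define a where "a = (\<Sum>k\<in>UNIV. ln (\<mu> $ k)) / real CARD('k)"
  have e: "exp (psi_init \<mu> $ i) = \<mu> $ i * exp (- a)" for i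
    using \<mu>_pos[of i] by (simp add: psi_init_def a_def exp_diff exp_minus divide_inverse)
  have "(\<Sum>k\<in>UNIV. exp (psi_init \<mu> $ k)) = exp (- a)"
    by (simp add: e \<mu>_sum flip: sum_distrib_right)
  then show ?thesis
    by (simp add: vec_eq_iff softmax_def e)
qed

lemma sum_psi_init: "(\<Sum>k\<in>UNIV. psi_init \<mu> $ k) = 0"
  by (simp add: psi_init_def sum_subtractf)

lemma optimal_0: "optimal 0 = psi_init \<mu>"
  by (rule optimal_eqI[symmetric]) (simp_all add: mass_zero softmax_psi_init sum_psi_init)

text \<open>
  Put \<open>d\<^sub>k = ln \<mu>\<^sub>k - q\<^sub>k\<close>, so that \<open>exp d\<^sub>k = \<integral> exp (- s C\<^sub>k) / Z\<close> with a normalisation \<open>Z\<close> common to all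
  \<open>k\<close>.  Hence \<open>d\<^sub>k - d\<^sub>l \<le> 2 s B\<close>, and \<open>psi_init - q\<close> is \<open>d\<close> minus its mean because \<open>q\<close> has zero sum.
\<close>

lemma optimal_near_init:
  assumes "0 \<le> s" and B: "\<And>x k. x \<in> space M \<Longrightarrow> \<bar>C x $ k\<bar> \<le> B"
  shows "\<bar>optimal s $ i - psi_init \<mu> $ i\<bar> \<le> 2 * s * B"
proof -
  define q where "q = optimal s"
  define d where "d k = ln (\<mu> $ k) - q $ k" for k
  have mass_nth: "\<mu> $ k = (\<integral>x. softmax (q - s *\<^sub>R C x) $ k \<partial>M)" for k
    using integral_bounded_linear[OF bounded_linear_vec_nth integrable_softmax[of q s], of k]
      optimal(2)[of s] by (simp add: mass_def q_def)
  have int: "integrable M (\<lambda>x. softmax (q - s *\<^sub>R C x) $ k)" for k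
    by (rule integrable_bounded_linear[OF bounded_linear_vec_nth integrable_softmax])
  have diff: "d k - d l \<le> 2 * s * B" for k l
  proof -
    have "exp (- q $ k) * softmax (q - s *\<^sub>R C x) $ k
        \<le> exp (2 * s * B) * (exp (- q $ l) * softmax (q - s *\<^sub>R C x) $ l)" if "x \<in> space M" for x
    proof -
      let ?Z = "\<Sum>k\<in>UNIV. exp ((q - s *\<^sub>R C x) $ k)"
      have n: "exp (- q $ k) * softmax (q - s *\<^sub>R C x) $ k = exp (- s * C x $ k) / ?Z" for k
        by (simp add: softmax_def exp_diff exp_minus field_simps)
      have "s * (C x $ l - C x $ k) \<le> s * (2 * B)"
        using B[OF that, of k] B[OF that, of l] \<open>0 \<le> s\<close> by (intro mult_left_mono) auto
      then have "exp (- s * C x $ k) \<le> exp (2 * s * B + - s * C x $ l)"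
        by (simp add: algebra_simps)
      then have "exp (- s * C x $ k) / ?Z \<le> exp (2 * s * B + - s * C x $ l) / ?Z"
        by (rule divide_right_mono) (rule less_imp_le[OF sum_exp_pos])
      then show ?thesis
        unfolding n exp_add by simp
    qed
    then have "(\<integral>x. exp (- q $ k) * softmax (q - s *\<^sub>R C x) $ k \<partial>M)
        \<le> (\<integral>x. exp (2 * s * B) * (exp (- q $ l) * softmax (q - s *\<^sub>R C x) $ l) \<partial>M)"
      by (intro integral_mono integrable_mult_right int)
    then have "exp (- q $ k) * \<mu> $ k \<le> exp (2 * s * B) * (exp (- q $ l) * \<mu> $ l)"
      by (simp add: mass_nth[symmetric])
    then have "ln (exp (- q $ k) * \<mu> $ k) \<le> ln (exp (2 * s * B) * (exp (- q $ l) * \<mu> $ l))"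
      using \<mu>_pos by (subst ln_le_cancel_iff) simp_all
    then show ?thesis
      using \<mu>_pos[of k] \<mu>_pos[of l] by (simp add: ln_mult d_def)
  qed
  have dsum: "(\<Sum>k\<in>UNIV. d k) = (\<Sum>k\<in>UNIV. ln (\<mu> $ k))"
    using optimal(1)[of s] by (simp add: d_def q_def sum_subtractf)
  \<comment> \<open>Averaging the differences over \<open>k\<close> compares \<open>d i\<close> with the mean of \<open>d\<close>.\<close>
  have "(\<Sum>k\<in>UNIV. d i - d k) \<le> (\<Sum>k\<in>(UNIV::'k set). 2 * s * B)"
       "(\<Sum>k\<in>UNIV. d k - d i) \<le> (\<Sum>k\<in>(UNIV::'k set). 2 * s * B)"
    by (intro sum_mono diff)+
  then have "real CARD('k) * \<bar>d i - (\<Sum>k\<in>UNIV. d k) / CARD('k)\<bar> \<le> real CARD('k) * (2 * s * B)"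
    by (simp add: sum_subtractf abs_if field_simps)
  then have "\<bar>d i - (\<Sum>k\<in>UNIV. d k) / CARD('k)\<bar> \<le> 2 * s * B"
    by (simp add: mult_le_cancel_left_pos)
  moreover have "d i - (\<Sum>k\<in>UNIV. d k) / CARD('k) = psi_init \<mu> $ i - optimal s $ i"
    by (simp add: dsum psi_init_def) (simp add: d_def q_def)
  ultimately show ?thesis by linarith
qed

text \<open>
  The trajectory is \<open>(1 - t)\<close> times a potential within \<open>2 (t / (1 - t)) B\<close> of the initial one, so the
  two contributions to the bound are \<open>(1 - t) 2 B\<close> and \<open>t 2 B\<close>.
\<close>

lemma trajectory_bound:
  assumes t: "0 \<le> t" "t < 1" and B: "\<And>x k. x \<in> space M \<Longrightarrow> \<bar>C x $ k\<bar> \<le> B"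
    and init: "\<bar>psi_init \<mu> $ i\<bar> \<le> 2 * B"
  shows "\<bar>trajectory t $ i\<bar> \<le> 2 * B"
proof -
  have "\<bar>potential t $ i\<bar> \<le> 2 * B + 2 * (t / (1 - t)) * B"
    using optimal_near_init[of "t / (1 - t)" B i] t B init by (simp add: potential_def)
  then have "(1 - t) * \<bar>potential t $ i\<bar> \<le> (1 - t) * (2 * B + 2 * (t / (1 - t)) * B)"
    using t by (intro mult_left_mono) auto
  also have "\<dots> = 2 * B"
    using t by (simp add: field_simps)
  finally show ?thesis
    using t by (simp add: trajectory_def abs_mult)
qed

end

section \<open>The Cauchy problem\<close>

lemma gradient_eqI:
  assumes "(f has_derivative (\<lambda>h. g \<bullet> h)) (at x)"
  shows "gradient f (at x) = g"
  unfolding gradient_def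
proof (rule the_equality)
  fix g' assume "(f has_derivative (\<lambda>h. g' \<bullet> h)) (at x)"
  then have "(\<lambda>h. g' \<bullet> h) = (\<lambda>h. g \<bullet> h)"
    using assms has_derivative_unique by blast
  then have "g' \<bullet> (g' - g) = g \<bullet> (g' - g)" by (rule fun_cong)
  then have "(g' - g) \<bullet> (g' - g) = 0" by (simp add: inner_diff_left)
  then show "g' = g" by simp
qed (rule assms)

text \<open>
  Derivatives within \<open>[0,1)\<close> are unique, also at the left end point.
\<close>

lemma at_within_unit_interval_nontrivial:
  assumes "t \<in> {0..<1::real}"
  shows "at t within {0..<1} \<noteq> bot"
proof -
  have "(0::real) \<in> {0..<1}" "1 / 2 \<in> {0..<1::real}" by auto
  then have "\<nexists>a. {0..<1::real} = {a}" by force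
  then have "t islimpt {0..<1}"
    using assms by (intro connected_imp_perfect) auto
  then show ?thesis by (simp add: trivial_limit_within)
qed

locale semidiscrete_transport = soft_transport M "\<lambda>x. \<chi> k. c x (y k)" K \<mu>
  for M :: "'a measure" and c :: "'a \<Rightarrow> 'b \<Rightarrow> real" and y :: "'k::finite \<Rightarrow> 'b"
    and K :: real and \<mu> :: "real^'k"
begin

lemma Phi_eq_dual:
  assumes "t < 1"
  shows "Phi M c y \<mu> \<psi> t = (1 - t) * dual (\<psi> /\<^sub>R (1 - t)) (t / (1 - t)) - (1 - t)"
proof -
  have "ln (\<Sum>k\<in>UNIV. exp ((\<psi> $ k - t * c x (y k)) / (1 - t)))
      = lse (\<psi> /\<^sub>R (1 - t) - (t / (1 - t)) *\<^sub>R (\<chi> k. c x (y k)))" for x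
    by (simp add: lse_def divide_inverse algebra_simps)
  moreover have "(1 - t) * ((\<psi> /\<^sub>R (1 - t)) \<bullet> \<mu>) = (\<Sum>k\<in>UNIV. \<psi> $ k * \<mu> $ k)"
  proof -
    have "(1 - t) * ((\<psi> /\<^sub>R (1 - t)) \<bullet> \<mu>) = \<psi> \<bullet> \<mu>" using assms by simp
    then show ?thesis by (simp add: inner_vec_def)
  qed
  ultimately show ?thesis
    by (simp add: Phi_def dual_def right_diff_distrib)
qed

lemma grad_Phi_eq:
  assumes "t < 1"
  shows "grad_Phi M c y \<mu> \<psi> t = mass (\<psi> /\<^sub>R (1 - t)) (t / (1 - t)) - \<mu>"
proof -
  let ?g = "mass (\<psi> /\<^sub>R (1 - t)) (t / (1 - t)) - \<mu>"
  have "((\<lambda>p. dual (p /\<^sub>R (1 - t)) (t / (1 - t))) has_derivative (\<lambda>h. ?g \<bullet> (h /\<^sub>R (1 - t)))) (at \<psi>)"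
    by (rule has_derivative_compose[OF _ has_derivative_dual])
       (intro has_derivative_scaleR_right has_derivative_ident)
  then have "((\<lambda>p. (1 - t) * dual (p /\<^sub>R (1 - t)) (t / (1 - t)) - (1 - t))
      has_derivative (\<lambda>h. (1 - t) * (?g \<bullet> (h /\<^sub>R (1 - t))) - 0)) (at \<psi>)"
    by (intro has_derivative_diff has_derivative_mult_right has_derivative_const)
  moreover have "(\<lambda>h. (1 - t) * (?g \<bullet> (h /\<^sub>R (1 - t))) - 0) = (\<lambda>h. ?g \<bullet> h)"
    using assms by (simp add: fun_eq_iff)
  ultimately have "((\<lambda>p. Phi M c y \<mu> p t) has_derivative (\<lambda>h. ?g \<bullet> h)) (at \<psi>)"
    unfolding Phi_eq_dual[OF assms] by (simp only:)
  then show ?thesis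
    unfolding grad_Phi_def by (rule gradient_eqI)
qed

text \<open>
  Differentiability jointly in \<open>(\<psi>,t)\<close> is what the chain rule needs along a curve that is
  differentiable at a single \<open>t\<close>.
\<close>

lemma joint_gradient_differentiable:
  assumes "t < 1"
  obtains L where "((\<lambda>p. mass (fst p /\<^sub>R (1 - snd p)) (snd p / (1 - snd p)) - \<mu>) has_derivative L) (at (\<psi>, t))"
proof -
  have fst: "(fst has_derivative fst) (at (\<psi>, t))" and rate:
    "((\<lambda>p::(real^'k) \<times> real. 1 - snd p) has_derivative (\<lambda>h. 0 - snd h)) (at (\<psi>, t))"
    and snd: "(snd has_derivative snd) (at (\<psi>, t))"
    by (intro has_derivative_diff has_derivative_const bounded_linear_imp_has_derivative
        bounded_linear_fst bounded_linear_snd)+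
  have nz: "1 - snd (\<psi>, t) \<noteq> 0" using assms by simp
  have "(\<lambda>p::(real^'k) \<times> real. (fst p /\<^sub>R (1 - snd p), snd p / (1 - snd p))) differentiable (at (\<psi>, t))"
    using has_derivative_Pair[OF has_derivative_scaleR[OF Deriv.has_derivative_inverse[OF nz rate] fst]
        has_derivative_divide[OF snd rate nz]]
    unfolding differentiable_def by blast
  then obtain S where "((\<lambda>p::(real^'k) \<times> real. (fst p /\<^sub>R (1 - snd p), snd p / (1 - snd p)))
      has_derivative S) (at (\<psi>, t))"
    unfolding differentiable_def by blast
  from has_derivative_compose[OF this has_derivative_mass]
  have "((\<lambda>p. mass (fst p /\<^sub>R (1 - snd p)) (snd p / (1 - snd p)) - \<mu>) has_derivative
      (\<lambda>h. mass_deriv (\<psi> /\<^sub>R (1 - t), t / (1 - t)) (S h) - 0)) (at (\<psi>, t))"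
    by (intro has_derivative_diff has_derivative_const) simp
  then show thesis by (rule that)
qed

text \<open>
  The left-hand side of the differential equation is the derivative of the gradient along the curve.
\<close>

lemma grad_Phi_along_curve:
  assumes t: "t \<in> {0..<1}" and \<phi>: "(\<phi> has_vector_derivative v) (at t within {0..<1})"
  shows "((\<lambda>s. grad_Phi M c y \<mu> (\<phi> s) s) has_vector_derivative
    hess_Phi M c y \<mu> (\<phi> t) t *v v + dt_grad_Phi M c y \<mu> (\<phi> t) t) (at t within {0..<1})"
proof -
  let ?F = "\<lambda>p. mass (fst p /\<^sub>R (1 - snd p)) (snd p / (1 - snd p)) - \<mu>"
  obtain L where L: "(?F has_derivative L) (at (\<phi> t, t))"
    using joint_gradient_differentiable[of t "\<phi> t"] t by auto
  then have lin: "linear L" by (rule has_derivative_linear)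
  have chain: "((\<lambda>s. grad_Phi M c y \<mu> (\<gamma> s) s) has_vector_derivative L (w, 1)) (at t within {0..<1})"
    if \<gamma>: "(\<gamma> has_vector_derivative w) (at t within {0..<1})" "\<gamma> t = \<phi> t" for \<gamma> w
  proof -
    have "((\<lambda>s. ?F (\<gamma> s, s)) has_derivative (\<lambda>h. L (h *\<^sub>R w, h))) (at t within {0..<1})"
      using has_derivative_compose[OF has_derivative_Pair[OF \<gamma>(1)[unfolded has_vector_derivative_def]
            has_derivative_ident], of ?F L] L \<gamma>(2) by simp
    moreover have "L (h *\<^sub>R w, h) = h *\<^sub>R L (w, 1)" for h
      using linear_scale[OF lin, of h "(w, 1)"] by simp
    ultimately have "((\<lambda>s. ?F (\<gamma> s, s)) has_vector_derivative L (w, 1)) (at t within {0..<1})"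
      by (simp add: has_vector_derivative_def)
    then show ?thesis
      using t by (rule has_vector_derivative_transform[rotated 2]) (simp add: grad_Phi_eq)
  qed
  have "dt_grad_Phi M c y \<mu> (\<phi> t) t = L (0, 1)"
    unfolding dt_grad_Phi_def
    by (rule vector_derivative_within[OF at_within_unit_interval_nontrivial[OF t] chain]) auto
  moreover have "hess_Phi M c y \<mu> (\<phi> t) t *v v = L (v, 0)"
  proof -
    have "((\<lambda>p. ?F (p, t)) has_derivative (\<lambda>h. L (h, 0))) (at (\<phi> t))"
      using has_derivative_compose[OF has_derivative_Pair[OF has_derivative_ident has_derivative_const] L] .
    then have "((\<lambda>p. grad_Phi M c y \<mu> p t) has_derivative (\<lambda>h. L (h, 0))) (at (\<phi> t))"
      using t by (simp add: grad_Phi_eq)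
    then have "frechet_derivative (\<lambda>p. grad_Phi M c y \<mu> p t) (at (\<phi> t)) = (\<lambda>h. L (h, 0))" "linear (\<lambda>h. L (h, 0))"
      by (auto dest: frechet_derivative_at has_derivative_linear)
    then show ?thesis
      unfolding hess_Phi_def jacobian_def
      using fun_cong[OF matrix_vector_mul(2), where x = v] by simp
  qed
  moreover have "L (v, 1) = L (v, 0) + L (0, 1)"
    using linear_add[OF lin, of "(v, 0)" "(0, 1)"] by simp
  ultimately show ?thesis
    using chain[OF \<phi>] by simp
qed

lemma rescale_iff:
  assumes "t < 1"
  shows "\<psi> /\<^sub>R (1 - t) = potential t \<longleftrightarrow> \<psi> = trajectory t"
proof
  assume eq: "\<psi> /\<^sub>R (1 - t) = potential t"
  show "\<psi> = trajectory t"
    unfolding trajectory_def eq[symmetric] using assms by simp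
qed (use assms in \<open>simp add: trajectory_def\<close>)

lemma grad_Phi_eq_0_iff:
  assumes "t < 1" "(\<Sum>k\<in>UNIV. \<psi> $ k) = 0"
  shows "grad_Phi M c y \<mu> \<psi> t = 0 \<longleftrightarrow> \<psi> = trajectory t"
proof -
  have "(\<Sum>k\<in>UNIV. (\<psi> /\<^sub>R (1 - t)) $ k) = 0"
    using assms by (simp flip: sum_divide_distrib sum_distrib_left)
  then have "mass (\<psi> /\<^sub>R (1 - t)) (t / (1 - t)) = \<mu> \<longleftrightarrow> \<psi> /\<^sub>R (1 - t) = potential t"
    using optimal_eqI optimal(2) unfolding potential_def by auto
  also have "\<dots> \<longleftrightarrow> \<psi> = trajectory t"
    using rescale_iff assms by simp
  finally show ?thesis
    using assms by (simp add: grad_Phi_eq)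
qed

lemma sum_trajectory: "(\<Sum>k\<in>UNIV. trajectory t $ k) = 0"
  using optimal(1) by (simp add: trajectory_def potential_def flip: sum_distrib_left)

lemma normalized_min_iff:
  assumes "t < 1"
  shows "normalized_min M c y \<mu> t \<psi> \<longleftrightarrow> \<psi> = trajectory t"
proof (cases "(\<Sum>k\<in>UNIV. \<psi> $ k) = 0")
  case True
  let ?s = "t / (1 - t)"
  have sum: "(\<Sum>k\<in>UNIV. (\<psi> /\<^sub>R (1 - t)) $ k) = 0"
    using True by (simp flip: sum_divide_distrib sum_distrib_left)
  have "normalized_min M c y \<mu> t \<psi> \<longleftrightarrow> (\<forall>p. Phi M c y \<mu> \<psi> t \<le> Phi M c y \<mu> p t)"
    using True by (auto simp: normalized_min_def is_arg_min_def not_less)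
  also have "\<dots> \<longleftrightarrow> (\<forall>p. dual (\<psi> /\<^sub>R (1 - t)) ?s \<le> dual (p /\<^sub>R (1 - t)) ?s)"
    using assms by (simp add: Phi_eq_dual)
  also have "\<dots> \<longleftrightarrow> (\<forall>q. dual (\<psi> /\<^sub>R (1 - t)) ?s \<le> dual q ?s)"
  proof (intro iffI allI)
    fix q assume "\<forall>p. dual (\<psi> /\<^sub>R (1 - t)) ?s \<le> dual (p /\<^sub>R (1 - t)) ?s"
    from this[rule_format, of "(1 - t) *\<^sub>R q"] show "dual (\<psi> /\<^sub>R (1 - t)) ?s \<le> dual q ?s"
      using assms by simp
  qed blast
  also have "\<dots> \<longleftrightarrow> \<psi> /\<^sub>R (1 - t) = potential t"
    using minimiser_iff[OF sum] by (simp add: potential_def)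
  also have "\<dots> \<longleftrightarrow> \<psi> = trajectory t"
    using rescale_iff assms by simp
  finally show ?thesis .
next
  case False
  then show ?thesis using sum_trajectory by (auto simp: normalized_min_def)
qed

lemma psi_opt_eq: "t < 1 \<Longrightarrow> psi_opt M c y \<mu> t = trajectory t"
  unfolding psi_opt_def by (rule the_equality) (simp_all add: normalized_min_iff)

text \<open>
  Along a solution the gradient is constant, and it vanishes at \<open>t = 0\<close>, where
  \<open>mass q 0 = softmax q\<close> and \<open>softmax (psi_init \<mu>) = \<mu>\<close>.  Conversely the gradient vanishes along the
  trajectory of minimisers, and so does its derivative.
\<close>

lemma cauchy_solution_in_zero_sum_iff:
  "cauchy_solution M c y \<mu> \<phi> \<and> (\<forall>t\<in>{0..<1}. \<phi> t \<in> zero_sum) \<longleftrightarrow> (\<forall>t\<in>{0..<1}. \<phi> t = trajectory t)"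
proof (intro iffI conjI)
  assume *: "cauchy_solution M c y \<mu> \<phi> \<and> (\<forall>t\<in>{0..<1}. \<phi> t \<in> zero_sum)"
  then have sum: "(\<Sum>k\<in>UNIV. \<phi> t $ k) = 0" if "t \<in> {0..<1}" for t
    using that by (auto simp: zero_sum_def)
  have "((\<lambda>s. grad_Phi M c y \<mu> (\<phi> s) s) has_vector_derivative 0) (at t within {0..<1})"
    if t: "t \<in> {0..<1}" for t
  proof -
    obtain v where "(\<phi> has_vector_derivative v) (at t within {0..<1})"
      "hess_Phi M c y \<mu> (\<phi> t) t *v v + dt_grad_Phi M c y \<mu> (\<phi> t) t = 0"
      using * t unfolding cauchy_solution_def by blast
    then show ?thesis using grad_Phi_along_curve[OF t, of \<phi> v] by simp
  qed
  then obtain g where g: "\<And>t. t \<in> {0..<1} \<Longrightarrow> grad_Phi M c y \<mu> (\<phi> t) t = g"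
    using has_vector_derivative_zero_constant[of "{0..<1::real}" "\<lambda>s. grad_Phi M c y \<mu> (\<phi> s) s"]
    by (auto simp: convex_real_interval)
  have "grad_Phi M c y \<mu> (\<phi> 0) 0 = 0"
    using * by (simp add: cauchy_solution_def grad_Phi_eq mass_zero softmax_psi_init)
  then have "g = 0" using g[of 0] by simp
  then show "\<forall>t\<in>{0..<1}. \<phi> t = trajectory t"
    using g grad_Phi_eq_0_iff sum by auto
next
  assume *: "\<forall>t\<in>{0..<1}. \<phi> t = trajectory t"
  then show "\<forall>t\<in>{0..<1}. \<phi> t \<in> zero_sum"
    by (simp add: zero_sum_def sum_trajectory)
  have "\<exists>v. (\<phi> has_vector_derivative v) (at t within {0..<1}) \<and>
      hess_Phi M c y \<mu> (\<phi> t) t *v v + dt_grad_Phi M c y \<mu> (\<phi> t) t = 0" if t: "t \<in> {0..<1}" for t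
  proof -
    obtain v where "(trajectory has_vector_derivative v) (at t within {..<1})"
    proof -
      from smooth_trajectory obtain D where D: "\<forall>t\<in>{..<1}. D 0 t = trajectory t"
        "\<forall>n. \<forall>t\<in>{..<1}. (D n has_vector_derivative D (Suc n) t) (at t within {..<1})"
        unfolding smooth_on_def by blast
      have "(D 0 has_vector_derivative D (Suc 0) t) (at t within {..<1})"
        using D(2) t by simp
      then have "(trajectory has_vector_derivative D (Suc 0) t) (at t within {..<1})"
        by (rule has_vector_derivative_transform[rotated 2]) (use D(1) t in auto)
      then show thesis by (rule that)
    qed
    then have "(trajectory has_vector_derivative v) (at t within {0..<1})"
      by (rule has_vector_derivative_within_subset) auto
    then have \<phi>: "(\<phi> has_vector_derivative v) (at t within {0..<1})"
      by (rule has_vector_derivative_transform[rotated 2]) (use * t in auto)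
    have "((\<lambda>s. grad_Phi M c y \<mu> (\<phi> s) s) has_vector_derivative 0) (at t within {0..<1})"
    proof (rule has_vector_derivative_transform[OF t])
      show "grad_Phi M c y \<mu> (\<phi> s) s = 0" if "s \<in> {0..<1}" for s
        using that * by (simp add: grad_Phi_eq_0_iff sum_trajectory)
    qed (rule has_vector_derivative_const)
    then have "hess_Phi M c y \<mu> (\<phi> t) t *v v + dt_grad_Phi M c y \<mu> (\<phi> t) t = 0"
      using vector_derivative_unique_within[OF at_within_unit_interval_nontrivial[OF t]]
        grad_Phi_along_curve[OF t \<phi>] by blast
    with \<phi> show ?thesis by blast
  qed
  moreover have "\<phi> 0 = psi_init \<mu>"
    using * by (simp add: trajectory_def potential_def optimal_0)
  ultimately show "cauchy_solution M c y \<mu> \<phi>"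
    unfolding cauchy_solution_def by simp
qed

lemma trajectory_in_U_set:
  assumes t: "t \<in> {0..<1}" and bdd: "\<And>x k. x \<in> space M \<Longrightarrow> \<bar>c x (y k)\<bar> \<le> sup_norm X (range y) c"
    and init: "psi_init \<mu> \<in> U_set X (range y) c"
  shows "trajectory t \<in> U_set X (range y) c"
proof -
  let ?B = "sup_norm X (range y) c"
  have "\<bar>psi_init \<mu> $ i\<bar> \<le> 2 * ?B" for i
    using init component_le_infnorm_cart[of "psi_init \<mu>" i] by (simp add: U_set_def)
  then have "\<bar>trajectory t $ i\<bar> \<le> 2 * ?B" for i
    using trajectory_bound[of t ?B i] t bdd by simp
  then have "infnorm (trajectory t) \<le> 2 * ?B"
    unfolding infnorm_cart by (intro cSup_least) auto
  then show ?thesis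
    by (simp add: U_set_def sum_trajectory)
qed

end

theorem theorem3p1:
  fixes X :: "(real^'n) set"
    and y :: "'k::finite \<Rightarrow> real^'n"
    and \<rho> :: "(real^'n) measure"
    and r :: "real^'n \<Rightarrow> real"
    and m_lo m_up \<mu>_lo :: real
    and \<mu> :: "real^'k"
    and c :: "real^'n \<Rightarrow> real^'n \<Rightarrow> real"
  assumes "compact X" and "convex X"
    and "inj y"
    and "prob_space \<rho>"
    and "r \<in> borel_measurable (restrict_space lborel X)"
    and "\<rho> = density (restrict_space lborel X) (\<lambda>x. ennreal (r x))"
    and "0 < m_lo" and "\<And>x. x \<in> X \<Longrightarrow> m_lo \<le> r x \<and> r x \<le> m_up"
    and "0 < \<mu>_lo" and "\<And>k. \<mu>_lo \<le> \<mu> $ k" and "(\<Sum>k\<in>UNIV. \<mu> $ k) = 1"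
    and "\<And>k. C1_on X (\<lambda>x. c x (y k))"
    and "\<And>x0. x0 \<in> X \<Longrightarrow> inj_on (\<lambda>z. gradient (\<lambda>x. c x z) (at x0 within X)) (range y)"
  shows "(\<forall>t\<in>{0..<1}. \<exists>!\<psi>. normalized_min \<rho> c y \<mu> t \<psi>) \<and>
    smooth_on {0..<1} (psi_opt \<rho> c y \<mu>) \<and>
    unique_cauchy_solution_in \<rho> c y \<mu> zero_sum (psi_opt \<rho> c y \<mu>) \<and>
    (psi_init \<mu> \<in> U_set X (range y) c \<longrightarrow>
      unique_cauchy_solution_in \<rho> c y \<mu> (U_set X (range y) c) (psi_opt \<rho> c y \<mu>))"
proof -
  let ?B = "sup_norm X (range y) c"
  have cont: "continuous_on X (\<lambda>x. c x (y k))" for k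
    using assms(12)[of k] unfolding C1_on_def
    by (intro differentiable_imp_continuous_on) (simp add: differentiable_on_def)
  have B: "\<bar>c x (y k)\<bar> \<le> ?B" if "x \<in> X" for x k
  proof -
    have "compact (\<Union>k. (\<lambda>x. \<bar>c x (y k)\<bar>) ` X)"
      using assms(1) cont by (intro compact_UN compact_continuous_image continuous_intros) auto
    moreover have "(\<lambda>(x, y). \<bar>c x y\<bar>) ` (X \<times> range y) = (\<Union>k. (\<lambda>x. \<bar>c x (y k)\<bar>) ` X)"
      by auto
    ultimately have "bdd_above ((\<lambda>(x, y). \<bar>c x y\<bar>) ` (X \<times> range y))"
      by (simp add: compact_imp_bounded bounded_imp_bdd_above)
    then have "(\<lambda>(x, y). \<bar>c x y\<bar>) (x, y k) \<le> ?B"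
      unfolding sup_norm_def using that by (intro cSUP_upper) auto
    then show ?thesis by simp
  qed
  have space: "space \<rho> = X" and sets: "sets \<rho> = sets (restrict_space borel X)"
    by (simp_all add: assms(6) space_restrict_space cong: sets_restrict_space_cong)
  interpret prob_space \<rho> by fact
  interpret semidiscrete_transport \<rho> c y "real CARD('k) * ?B" \<mu>
  proof unfold_locales
    show "(\<lambda>x. \<chi> k. c x (y k)) \<in> borel_measurable \<rho>"
      by (intro borel_measurable_vec_lambda, subst measurable_cong_sets[OF sets refl])
         (rule borel_measurable_continuous_on_restrict[OF cont])
    \<comment> \<open>The locale bounds the Euclidean norm, which is at most the sum of the entries.\<close>
    show "norm (\<chi> k. c x (y k)) \<le> real CARD('k) * ?B" if "x \<in> space \<rho>" for x
    proof -
      have "norm (\<chi> k. c x (y k)) \<le> (\<Sum>k\<in>UNIV. \<bar>c x (y k)\<bar>)"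
        using norm_le_l1_cart[of "\<chi> k. c x (y k)"] by simp
      also have "\<dots> \<le> (\<Sum>k\<in>(UNIV::'k set). ?B)"
        using that by (intro sum_mono B) (simp add: space)
      finally show ?thesis by simp
    qed
    show "0 < \<mu> $ k" for k
      using assms(9) assms(10)[of k] by linarith
    show "(\<Sum>k\<in>UNIV. \<mu> $ k) = 1" by fact
  qed
  have psi: "psi_opt \<rho> c y \<mu> t = trajectory t" if "t \<in> {0..<1}" for t
    using that by (simp add: psi_opt_eq)
  have "\<forall>t\<in>{0..<1}. \<exists>!\<psi>. normalized_min \<rho> c y \<mu> t \<psi>"
    by (simp add: normalized_min_iff)
  moreover have "smooth_on {0..<1} (psi_opt \<rho> c y \<mu>)"
  proof -
    obtain D where D: "\<forall>t\<in>{..<1}. D 0 t = trajectory t"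
        "\<forall>n. \<forall>t\<in>{..<1}. (D n has_vector_derivative D (Suc n) t) (at t within {..<1})"
      using smooth_trajectory unfolding smooth_on_def by blast
    have "(D n has_vector_derivative D (Suc n) t) (at t within {0..<1})" if "t \<in> {0..<1}" for n t
      by (rule has_vector_derivative_within_subset[where S = "{..<1}"]) (use D(2) that in auto)
    with D(1) psi show ?thesis
      unfolding smooth_on_def by (intro exI[of _ D]) auto
  qed
  moreover have "unique_cauchy_solution_in \<rho> c y \<mu> zero_sum (psi_opt \<rho> c y \<mu>)"
    unfolding unique_cauchy_solution_in_def cauchy_solution_in_zero_sum_iff by (simp add: psi)
  moreover have "unique_cauchy_solution_in \<rho> c y \<mu> (U_set X (range y) c) (psi_opt \<rho> c y \<mu>)"
    if init: "psi_init \<mu> \<in> U_set X (range y) c"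
  proof -
    have "trajectory t \<in> U_set X (range y) c" if "t \<in> {0..<1}" for t
      by (rule trajectory_in_U_set[OF that _ init]) (use B space in auto)
    moreover have "U_set X (range y) c \<subseteq> zero_sum"
      by (auto simp: U_set_def zero_sum_def)
    ultimately have "cauchy_solution \<rho> c y \<mu> \<phi> \<and> (\<forall>t\<in>{0..<1}. \<phi> t \<in> U_set X (range y) c)
        \<longleftrightarrow> (\<forall>t\<in>{0..<1}. \<phi> t = trajectory t)" for \<phi>
      using cauchy_solution_in_zero_sum_iff[of \<phi>] by (intro iffI) (blast, auto)
    then show ?thesis
      by (simp add: unique_cauchy_solution_in_def psi)
  qed
  ultimately show ?thesis by blast
qed

end
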